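(* The Lipschitz MAB problem on a fixed metric space $(X,\mathcal{D})$ is $f(t)$-tractable for some $f\in o(t)$ if and only if the metric completion of $(X,\mathcal{D})$ is a compact metric space.
   Context: Lipschitz MAB problem on a metric space $(X,\mathcal{D})$ (of diameter at most $1$): $(X,\mathcal{D})$ is known to the algorithm. A problem instance $I$ consists of an unknown payoff function $\mu:X\to[0,1]$ with $|\mu(x)-\mu(y)|\le\mathcal{D}(x,y)$ for all $x,y$, and for each $x$ a distribution on $[0,1]$ with mean $\mu(x)$. In each round $t$ the algorithm picks $x_t\in X$ and receives an independent reward from the distribution of $x_t$. Regret: $R(t)=t\sup_x\mu(x)-\mathbb{E}[\sum_{s\le t}\mu(x_s)]$. The problem is $f(t)$-tractable if there is an algorithm such that for every instance $I$ there is a constant $C_I$ with $R(t)\le C_I f(t)$ for all $t$; $f\in o(t)$ means $f(t)/t\to0$. *)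

theory Defs
  imports "HOL-Probability.Probability"
begin

section \<open>Metric completion\<close>

definition cauchy_rel :: "'a set \<Rightarrow> ('a \<Rightarrow> 'a \<Rightarrow> real) \<Rightarrow> ((nat \<Rightarrow> 'a) \<times> (nat \<Rightarrow> 'a)) set" where
  "cauchy_rel X D = {(\<sigma>, \<tau>). Metric_space.MCauchy X D \<sigma> \<and> Metric_space.MCauchy X D \<tau> \<and>
     (\<lambda>n. D (\<sigma> n) (\<tau> n)) \<longlonglongrightarrow> 0}"

definition completion_space :: "'a set \<Rightarrow> ('a \<Rightarrow> 'a \<Rightarrow> real) \<Rightarrow> (nat \<Rightarrow> 'a) set set" where
  "completion_space X D = {\<sigma>. Metric_space.MCauchy X D \<sigma>} // cauchy_rel X D"

text \<open>The value \<open>0\<close> off the carrier is there because the locale \<^locale>\<open>Metric_space\<close> demands a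
  nonnegative symmetric function on the whole type.\<close>

definition completion_dist ::
  "'a set \<Rightarrow> ('a \<Rightarrow> 'a \<Rightarrow> real) \<Rightarrow> (nat \<Rightarrow> 'a) set \<Rightarrow> (nat \<Rightarrow> 'a) set \<Rightarrow> real" where
  "completion_dist X D P Q =
     (if P \<in> completion_space X D \<and> Q \<in> completion_space X D
      then THE r. \<forall>\<sigma>\<in>P. \<forall>\<tau>\<in>Q. (\<lambda>n. D (\<sigma> n) (\<tau> n)) \<longlonglongrightarrow> r else 0)"

context Metric_space
begin

lemma dist_diff_le:
  assumes "a \<in> M" "b \<in> M" "x \<in> M" "y \<in> M"
  shows "\<bar>d a b - d x y\<bar> \<le> d a x + d b y"
  using triangle[of a x b] triangle[of x y b] triangle[of x a y] triangle[of a b y] assms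
    commute[of x a] commute[of y b] by linarith

lemma convergent_dist_MCauchy:
  assumes "MCauchy \<sigma>" "MCauchy \<tau>"
  shows "convergent (\<lambda>n. d (\<sigma> n) (\<tau> n))"
proof (rule Cauchy_convergent, rule metric_CauchyI)
  fix e :: real assume "e > 0"
  then have e: "e/2 > 0" by simp
  obtain N1 where N1: "\<And>n n'. N1 \<le> n \<Longrightarrow> N1 \<le> n' \<Longrightarrow> d (\<sigma> n) (\<sigma> n') < e/2"
    using assms(1) e unfolding MCauchy_def by meson
  obtain N2 where N2: "\<And>n n'. N2 \<le> n \<Longrightarrow> N2 \<le> n' \<Longrightarrow> d (\<tau> n) (\<tau> n') < e/2"
    using assms(2) e unfolding MCauchy_def by meson
  have in_M: "\<sigma> n \<in> M" "\<tau> n \<in> M" for n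
    using assms by (auto simp: MCauchy_def)
  have "dist (d (\<sigma> m) (\<tau> m)) (d (\<sigma> n) (\<tau> n)) < e" if "m \<ge> max N1 N2" "n \<ge> max N1 N2" for m n
    using dist_diff_le[OF in_M in_M, of m m n n] N1[of m n] N2[of m n] that
    by (simp add: dist_real_def)
  then show "\<exists>K. \<forall>m\<ge>K. \<forall>n\<ge>K. dist (d (\<sigma> m) (\<tau> m)) (d (\<sigma> n) (\<tau> n)) < e"
    by blast
qed

lemma LIMSEQ_dist_cauchy_rel:
  assumes "(\<sigma>, \<sigma>') \<in> cauchy_rel M d" "(\<tau>, \<tau>') \<in> cauchy_rel M d"
    and "(\<lambda>n. d (\<sigma> n) (\<tau> n)) \<longlonglongrightarrow> r"
  shows "(\<lambda>n. d (\<sigma>' n) (\<tau>' n)) \<longlonglongrightarrow> r"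
proof -
  have in_M: "\<sigma> n \<in> M" "\<tau> n \<in> M" "\<sigma>' n \<in> M" "\<tau>' n \<in> M" for n
    using assms by (auto simp: cauchy_rel_def MCauchy_def)
  have "(\<lambda>n. d (\<sigma> n) (\<sigma>' n) + d (\<tau> n) (\<tau>' n)) \<longlonglongrightarrow> 0 + 0"
    using assms by (intro tendsto_add) (auto simp: cauchy_rel_def)
  moreover have "\<forall>\<^sub>F n in sequentially. norm (d (\<sigma> n) (\<tau> n) - d (\<sigma>' n) (\<tau>' n))
      \<le> d (\<sigma> n) (\<sigma>' n) + d (\<tau> n) (\<tau>' n)"
    using dist_diff_le[OF in_M(1,2) in_M(3,4)] by simp
  ultimately have "(\<lambda>n. d (\<sigma> n) (\<tau> n) - d (\<sigma>' n) (\<tau>' n)) \<longlonglongrightarrow> 0"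
    by (metis Lim_null_comparison add_0)
  from tendsto_diff[OF assms(3) this] show ?thesis by simp
qed

lemma equiv_cauchy_rel: "equiv {\<sigma>. MCauchy \<sigma>} (cauchy_rel M d)"
proof (rule equivI)
  show "cauchy_rel M d \<subseteq> {\<sigma>. MCauchy \<sigma>} \<times> {\<sigma>. MCauchy \<sigma>}"
    by (auto simp: cauchy_rel_def)
  show "refl_on {\<sigma>. MCauchy \<sigma>} (cauchy_rel M d)"
    by (auto simp: refl_on_def cauchy_rel_def MCauchy_def image_subset_iff)
  show "sym (cauchy_rel M d)"
    by (auto simp: sym_def cauchy_rel_def commute)
  show "trans (cauchy_rel M d)"
  proof (rule transI)
    fix \<rho> \<sigma> \<tau> assume 1: "(\<rho>, \<sigma>) \<in> cauchy_rel M d" and 2: "(\<sigma>, \<tau>) \<in> cauchy_rel M d"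
    then have "(\<rho>, \<rho>) \<in> cauchy_rel M d"
      by (auto simp: cauchy_rel_def MCauchy_def image_subset_iff)
    from LIMSEQ_dist_cauchy_rel[OF this 2] 1 2 show "(\<rho>, \<tau>) \<in> cauchy_rel M d"
      by (auto simp: cauchy_rel_def)
  qed
qed

lemma completion_class_eq:
  "P \<in> completion_space M d \<Longrightarrow> \<sigma> \<in> P \<Longrightarrow> P = cauchy_rel M d `` {\<sigma>}"
  unfolding completion_space_def
  by (erule quotientE) (auto dest: equiv_class_eq[OF equiv_cauchy_rel])

lemma completion_class_MCauchy: "P \<in> completion_space M d \<Longrightarrow> \<sigma> \<in> P \<Longrightarrow> MCauchy \<sigma>"
  unfolding completion_space_def using in_quotient_imp_subset[OF equiv_cauchy_rel] by blast

lemma completion_class_nonempty: "P \<in> completion_space M d \<Longrightarrow> \<exists>\<sigma>. \<sigma> \<in> P"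
  unfolding completion_space_def using in_quotient_imp_non_empty[OF equiv_cauchy_rel] by blast

lemma cauchy_class_in: "MCauchy \<sigma> \<Longrightarrow> cauchy_rel M d `` {\<sigma>} \<in> completion_space M d"
  by (simp add: completion_space_def quotientI)

lemma self_in_cauchy_class: "MCauchy \<sigma> \<Longrightarrow> \<sigma> \<in> cauchy_rel M d `` {\<sigma>}"
  using equiv_class_self[OF equiv_cauchy_rel] by simp

lemma completion_dist_lim:
  assumes P: "P \<in> completion_space M d" and Q: "Q \<in> completion_space M d" and "\<sigma> \<in> P" "\<tau> \<in> Q"
  shows "(\<lambda>n. d (\<sigma> n) (\<tau> n)) \<longlonglongrightarrow> completion_dist M d P Q"
proof -
  obtain r where r: "(\<lambda>n. d (\<sigma> n) (\<tau> n)) \<longlonglongrightarrow> r"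
    using convergent_dist_MCauchy[of \<sigma> \<tau>] completion_class_MCauchy assms
    by (auto simp: convergent_def)
  have *: "\<forall>\<sigma>'\<in>P. \<forall>\<tau>'\<in>Q. (\<lambda>n. d (\<sigma>' n) (\<tau>' n)) \<longlonglongrightarrow> r"
    using LIMSEQ_dist_cauchy_rel[OF _ _ r] completion_class_eq[OF P \<open>\<sigma> \<in> P\<close>]
      completion_class_eq[OF Q \<open>\<tau> \<in> Q\<close>] by blast
  have "(THE r. \<forall>\<sigma>\<in>P. \<forall>\<tau>\<in>Q. (\<lambda>n. d (\<sigma> n) (\<tau> n)) \<longlonglongrightarrow> r) = r"
    proof (rule the_equality)
    show "\<forall>\<sigma>\<in>P. \<forall>\<tau>\<in>Q. (\<lambda>n. d (\<sigma> n) (\<tau> n)) \<longlonglongrightarrow> r" using * .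
  next
    fix r' assume "\<forall>\<sigma>\<in>P. \<forall>\<tau>\<in>Q. (\<lambda>n. d (\<sigma> n) (\<tau> n)) \<longlonglongrightarrow> r'"
    then show "r' = r" using LIMSEQ_unique[OF _ r] assms(3,4) by blast
  qed
  with r P Q show ?thesis by (simp add: completion_dist_def)
qed

lemma Metric_space_completion: "Metric_space (completion_space M d) (completion_dist M d)"
proof
  fix P Q
  have carrier: "0 \<le> completion_dist M d P Q \<and> completion_dist M d P Q = completion_dist M d Q P"
    if PQ: "P \<in> completion_space M d" "Q \<in> completion_space M d"
  proof -
    obtain \<sigma> \<tau> where st: "\<sigma> \<in> P" "\<tau> \<in> Q" using PQ completion_class_nonempty by meson
    have l: "(\<lambda>n. d (\<sigma> n) (\<tau> n)) \<longlonglongrightarrow> completion_dist M d P Q"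
      "(\<lambda>n. d (\<sigma> n) (\<tau> n)) \<longlonglongrightarrow> completion_dist M d Q P"
      using completion_dist_lim[OF PQ st] completion_dist_lim[OF PQ(2,1) st(2,1)]
      by (simp_all add: commute)
    show ?thesis
      using LIMSEQ_unique[OF l] LIMSEQ_le_const[OF l(1), of 0] by simp
  qed
  then show "0 \<le> completion_dist M d P Q"
    by (cases "P \<in> completion_space M d \<and> Q \<in> completion_space M d") (auto simp: completion_dist_def)
  from carrier show "completion_dist M d P Q = completion_dist M d Q P"
    by (cases "P \<in> completion_space M d \<and> Q \<in> completion_space M d") (auto simp: completion_dist_def)
next
  fix P Q assume PQ: "P \<in> completion_space M d" "Q \<in> completion_space M d"
  obtain \<sigma> \<tau> where st: "\<sigma> \<in> P" "\<tau> \<in> Q" using PQ completion_class_nonempty by meson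
  note l = completion_dist_lim[OF PQ st]
  have c: "MCauchy \<sigma>" "MCauchy \<tau>" using completion_class_MCauchy PQ st by auto
  show "completion_dist M d P Q = 0 \<longleftrightarrow> P = Q"
  proof
    assume "completion_dist M d P Q = 0"
    then have "(\<sigma>, \<tau>) \<in> cauchy_rel M d" using l c by (simp add: cauchy_rel_def)
    then show "P = Q"
      using completion_class_eq PQ st equiv_class_eq[OF equiv_cauchy_rel] by metis
  next
    assume "P = Q"
    then have "(\<lambda>n. d (\<sigma> n) (\<sigma> n)) \<longlonglongrightarrow> completion_dist M d P Q"
      using completion_dist_lim[OF PQ] st by simp
    moreover have "d (\<sigma> n) (\<sigma> n) = 0" for n
      using c by (auto simp: MCauchy_def image_subset_iff)
    ultimately show "completion_dist M d P Q = 0" by (simp add: LIMSEQ_const_iff)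
  qed
next
  fix P Q R
  assume PQR: "P \<in> completion_space M d" "Q \<in> completion_space M d" "R \<in> completion_space M d"
  obtain \<rho> \<sigma> \<tau> where st: "\<rho> \<in> P" "\<sigma> \<in> Q" "\<tau> \<in> R" using PQR completion_class_nonempty by meson
  have in_M: "\<rho> n \<in> M" "\<sigma> n \<in> M" "\<tau> n \<in> M" for n
    using completion_class_MCauchy PQR st by (auto simp: MCauchy_def image_subset_iff)
  show "completion_dist M d P R \<le> completion_dist M d P Q + completion_dist M d Q R"
    using LIMSEQ_le[OF completion_dist_lim[OF PQR(1,3) st(1,3)]
        tendsto_add[OF completion_dist_lim[OF PQR(1,2) st(1,2)] completion_dist_lim[OF PQR(2,3) st(2,3)]]]
      triangle[OF in_M] by blast
qed

definition completion_embed :: "'a \<Rightarrow> (nat \<Rightarrow> 'a) set" where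
  "completion_embed x = cauchy_rel M d `` {\<lambda>_. x}"

lemma completion_embed_in: "x \<in> M \<Longrightarrow> completion_embed x \<in> completion_space M d"
  by (simp add: completion_embed_def cauchy_class_in)

lemma const_in_completion_embed: "x \<in> M \<Longrightarrow> (\<lambda>_. x) \<in> completion_embed x"
  unfolding completion_embed_def by (rule self_in_cauchy_class) simp

lemma completion_dist_embed:
  "x \<in> M \<Longrightarrow> y \<in> M \<Longrightarrow> completion_dist M d (completion_embed x) (completion_embed y) = d x y"
  using completion_dist_lim[OF completion_embed_in completion_embed_in const_in_completion_embed
      const_in_completion_embed, of x y] by (simp add: LIMSEQ_const_iff)

lemma completion_dist_embed_seq:
  assumes \<sigma>: "MCauchy \<sigma>"
  shows "(\<lambda>n. completion_dist M d (completion_embed (\<sigma> n)) (cauchy_rel M d `` {\<sigma>})) \<longlonglongrightarrow> 0"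
proof (rule LIMSEQ_I)
  fix e :: real assume "e > 0"
  then obtain N where N: "\<And>n n'. N \<le> n \<Longrightarrow> N \<le> n' \<Longrightarrow> d (\<sigma> n) (\<sigma> n') < e/2"
    using \<sigma> unfolding MCauchy_def by (meson half_gt_zero)
  interpret C: Metric_space "completion_space M d" "completion_dist M d"
    by (rule Metric_space_completion)
  have "completion_dist M d (completion_embed (\<sigma> n)) (cauchy_rel M d `` {\<sigma>}) \<le> e/2" if "n \<ge> N" for n
  proof -
    have s: "\<sigma> n \<in> M" using \<sigma> by (auto simp: MCauchy_def)
    show ?thesis
      using LIMSEQ_le_const2[OF completion_dist_lim[OF completion_embed_in[OF s] cauchy_class_in[OF \<sigma>]
        const_in_completion_embed[OF s] self_in_cauchy_class[OF \<sigma>]], of "e/2"] N[OF that]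
      by (meson less_imp_le)
  qed
  then show "\<exists>no. \<forall>n\<ge>no. norm (completion_dist M d (completion_embed (\<sigma> n)) (cauchy_rel M d `` {\<sigma>}) - 0) < e"
    using \<open>e > 0\<close> by (intro exI[of _ N]) (fastforce)
qed

lemma completion_embed_dense:
  "Metric_space.mtopology (completion_space M d) (completion_dist M d) closure_of (completion_embed ` M)
     = completion_space M d"
proof -
  interpret C: Metric_space "completion_space M d" "completion_dist M d"
    by (rule Metric_space_completion)
  have "\<exists>y\<in>completion_embed ` M. y \<in> C.mball P r" if P: "P \<in> completion_space M d" and "r > 0" for P r
  proof -
    obtain \<sigma> where s: "\<sigma> \<in> P" using P completion_class_nonempty by blast
    have c: "MCauchy \<sigma>" using completion_class_MCauchy P s by blast
    have eq: "P = cauchy_rel M d `` {\<sigma>}" by (rule completion_class_eq[OF P s])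
    have "(\<lambda>n. completion_dist M d (completion_embed (\<sigma> n)) P) \<longlonglongrightarrow> 0"
      using completion_dist_embed_seq[OF c] eq by simp
    from LIMSEQ_D[OF this \<open>r > 0\<close>]
    obtain n where n: "completion_dist M d (completion_embed (\<sigma> n)) P < r"
      by auto
    have s_in: "\<sigma> n \<in> M" using c by (auto simp: MCauchy_def)
    have "completion_embed (\<sigma> n) \<in> C.mball P r"
      using n P completion_embed_in[OF s_in] C.commute[of P] by (simp add: C.in_mball)
    then show ?thesis using s_in by blast
  qed
  then show ?thesis
    unfolding C.metric_closure_of by blast
qed

lemma mcomplete_completion: "Metric_space.mcomplete (completion_space M d) (completion_dist M d)"
proof -
  interpret C: Metric_space "completion_space M d" "completion_dist M d"
    by (rule Metric_space_completion)
  let ?D = "completion_dist M d"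
  show ?thesis unfolding C.mcomplete_def
  proof (intro allI impI)
    fix F assume F: "C.MCauchy F"
    then have F_in: "F n \<in> completion_space M d" for n
      by (auto simp: C.MCauchy_def)
    have "\<exists>x\<in>M. ?D (completion_embed x) (F n) < 1 / real (Suc n)" for n
    proof -
      have "F n \<in> C.mtopology closure_of (completion_embed ` M)"
        using F_in completion_embed_dense by simp
      then obtain y where "y \<in> completion_embed ` M" "y \<in> C.mball (F n) (1 / real (Suc n))"
        unfolding C.metric_closure_of using zero_less_divide_1_iff of_nat_0_less_iff zero_less_Suc by blast
      then show ?thesis using C.commute[of "F n"] by (auto simp: C.in_mball)
    qed
    then obtain x where x: "\<And>n. x n \<in> M" "\<And>n. ?D (completion_embed (x n)) (F n) < 1 / real (Suc n)"
      by metis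
    let ?x = "\<lambda>n. completion_embed (x n)"
    have x_in: "?x n \<in> completion_space M d" for n using x completion_embed_in by blast
    have lim: "(\<lambda>n. ?D (?x n) (F n)) \<longlonglongrightarrow> 0"
    proof (rule Lim_null_comparison)
      show "\<forall>\<^sub>F n in sequentially. norm (?D (?x n) (F n)) \<le> 1 / real (Suc n)"
        using x(2) by (intro always_eventually) (auto intro: less_imp_le)
      show "(\<lambda>n. 1 / real (Suc n)) \<longlonglongrightarrow> 0"
        using LIMSEQ_inverse_real_of_nat by (simp add: field_simps)
    qed
    have "MCauchy x" unfolding MCauchy_def
    proof (intro conjI allI impI)
      show "range x \<subseteq> M" using x by blast
      fix e :: real assume "e > 0"
      then have e: "e/3 > 0" by simp
      obtain N1 where N1: "\<And>n n'. N1 \<le> n \<Longrightarrow> N1 \<le> n' \<Longrightarrow> ?D (F n) (F n') < e/3"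
        using F e unfolding C.MCauchy_def by meson
      obtain N2 where N2: "\<And>n. N2 \<le> n \<Longrightarrow> ?D (?x n) (F n) < e/3"
        using LIMSEQ_D[OF lim e] by auto
      have "d (x n) (x n') < e" if "max N1 N2 \<le> n" "max N1 N2 \<le> n'" for n n'
      proof -
        have "d (x n) (x n') = ?D (?x n) (?x n')" using x completion_dist_embed by simp
        also have "\<dots> \<le> ?D (?x n) (F n) + ?D (F n) (F n') + ?D (F n') (?x n')"
          using C.triangle[OF x_in[of n] F_in[of n] x_in[of n']] C.triangle[OF F_in[of n] F_in[of n'] x_in[of n']] by simp
        also have "\<dots> < e" using N1[of n n'] N2[of n] N2[of n'] that C.commute[of "F n'"] by simp
        finally show ?thesis .
      qed
      then show "\<exists>N. \<forall>n n'. N \<le> n \<longrightarrow> N \<le> n' \<longrightarrow> d (x n) (x n') < e" by blast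
    qed
    let ?L = "cauchy_rel M d `` {x}"
    have L_in: "?L \<in> completion_space M d" using \<open>MCauchy x\<close> cauchy_class_in by blast
    have "(\<lambda>n. ?D (F n) ?L) \<longlonglongrightarrow> 0"
    proof (rule Lim_null_comparison)
      have "norm (?D (F n) ?L) \<le> ?D (?x n) (F n) + ?D (?x n) ?L" for n
        using C.triangle[OF F_in[of n] x_in[of n] L_in] C.commute[of "F n" "?x n"] by simp
      then show "\<forall>\<^sub>F n in sequentially. norm (?D (F n) ?L) \<le> ?D (?x n) (F n) + ?D (?x n) ?L"
        by (rule always_eventually[OF allI])
      show "(\<lambda>n. ?D (?x n) (F n) + ?D (?x n) ?L) \<longlonglongrightarrow> 0"
        using tendsto_add[OF lim completion_dist_embed_seq[OF \<open>MCauchy x\<close>]] by simp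
    qed
    then have "limitin C.mtopology F ?L sequentially"
      using L_in F_in by (simp add: C.limitin_metric_dist_null)
    then show "\<exists>L. limitin C.mtopology F L sequentially" by blast
  qed
qed

end

section \<open>The Lipschitz multi-armed bandit problem\<close>

text \<open>An \<^emph>\<open>arm space\<close> equips \<open>X\<close> with a \<open>\<sigma>\<close>-algebra (carried by a measure \<open>M\<close> of which only
  \<^term>\<open>sets M\<close> matters) containing the Borel sets of the metric. Algorithms and reward
  distributions are required to be measurable with respect to it, so that the expectation in the
  regret exists. The Borel \<open>\<sigma>\<close>-algebra and the discrete one are the extreme cases; for the latter
  the measurability requirement on the reward distributions is void.\<close>

definition arm_space :: "'a set \<Rightarrow> ('a \<Rightarrow> 'a \<Rightarrow> real) \<Rightarrow> 'a measure \<Rightarrow> bool" where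
  "arm_space X D M \<longleftrightarrow> space M = X \<and> (\<forall>U. openin (Metric_space.mtopology X D) U \<longrightarrow> U \<in> sets M)"

definition lipschitz_mab_instance ::
  "'a set \<Rightarrow> ('a \<Rightarrow> 'a \<Rightarrow> real) \<Rightarrow> 'a measure \<Rightarrow> ('a \<Rightarrow> real) \<Rightarrow> ('a \<Rightarrow> real measure) \<Rightarrow> bool" where
  "lipschitz_mab_instance X D M \<mu> \<nu> \<longleftrightarrow>
     \<mu> \<in> X \<rightarrow> {0..1} \<and>
     (\<forall>x\<in>X. \<forall>y\<in>X. \<bar>\<mu> x - \<mu> y\<bar> \<le> D x y) \<and>
     \<nu> \<in> M \<rightarrow>\<^sub>M prob_algebra borel \<and>
     (\<forall>x\<in>X. emeasure (\<nu> x) {0..1} = 1 \<and> (\<integral>y. y \<partial>\<nu> x) = \<mu> x)"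

text \<open>A (randomized) algorithm maps the history of the rounds \<open>0, \<dots>, t - 1\<close>, a sequence of pairs
  (arm, reward), to the distribution of the arm picked in round \<open>t\<close>.\<close>

definition bandit_algorithm :: "'a measure \<Rightarrow> (nat \<Rightarrow> (nat \<Rightarrow> 'a \<times> real) \<Rightarrow> 'a measure) \<Rightarrow> bool" where
  "bandit_algorithm M A \<longleftrightarrow> (\<forall>t. A t \<in> PiM {0..<t} (\<lambda>_. M \<Otimes>\<^sub>M borel) \<rightarrow>\<^sub>M prob_algebra M)"

definition round_kernel ::
  "'a measure \<Rightarrow> (nat \<Rightarrow> (nat \<Rightarrow> 'a \<times> real) \<Rightarrow> 'a measure) \<Rightarrow> ('a \<Rightarrow> real measure) \<Rightarrow>
    nat \<Rightarrow> (nat \<Rightarrow> 'a \<times> real) \<Rightarrow> ('a \<times> real) measure" where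
  "round_kernel M A \<nu> t h = A t h \<bind> (\<lambda>x. distr (\<nu> x) (M \<Otimes>\<^sub>M borel) (\<lambda>y. (x, y)))"

text \<open>Law of the first \<open>t\<close> rounds: in the locale \<^locale>\<open>Ionescu_Tulcea\<close>, the constant \<open>C 0 t\<close> started in
  the empty history composes the first \<open>t\<close> kernels.\<close>

definition history_law ::
  "'a measure \<Rightarrow> (nat \<Rightarrow> (nat \<Rightarrow> 'a \<times> real) \<Rightarrow> 'a measure) \<Rightarrow> ('a \<Rightarrow> real measure) \<Rightarrow>
    nat \<Rightarrow> (nat \<Rightarrow> 'a \<times> real) measure" where
  "history_law M A \<nu> t =
     Ionescu_Tulcea.C (round_kernel M A \<nu>) (\<lambda>_. M \<Otimes>\<^sub>M borel) 0 t (\<lambda>_. undefined)"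

definition regret ::
  "'a measure \<Rightarrow> (nat \<Rightarrow> (nat \<Rightarrow> 'a \<times> real) \<Rightarrow> 'a measure) \<Rightarrow> ('a \<Rightarrow> real) \<Rightarrow> ('a \<Rightarrow> real measure) \<Rightarrow>
    nat \<Rightarrow> real" where
  "regret M A \<mu> \<nu> t =
     real t * (SUP x\<in>space M. \<mu> x) - (\<integral>h. (\<Sum>s<t. \<mu> (fst (h s))) \<partial>history_law M A \<nu> t)"

definition tractable ::
  "'a set \<Rightarrow> ('a \<Rightarrow> 'a \<Rightarrow> real) \<Rightarrow> 'a measure \<Rightarrow> (nat \<Rightarrow> real) \<Rightarrow> bool" where
  "tractable X D M f \<longleftrightarrow>
     (\<exists>A. bandit_algorithm M A \<and>
       (\<forall>\<mu> \<nu>. lipschitz_mab_instance X D M \<mu> \<nu> \<longrightarrow>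
         (\<exists>C. \<forall>t\<ge>1. regret M A \<mu> \<nu> t \<le> C * f t)))"

lemma Ionescu_Tulcea_round_kernel:
  assumes A: "bandit_algorithm M A" and \<nu>: "\<nu> \<in> M \<rightarrow>\<^sub>M prob_algebra borel"
  shows "Ionescu_Tulcea (round_kernel M A \<nu>) (\<lambda>_. M \<Otimes>\<^sub>M borel)"
proof -
  have "(\<lambda>x. distr (\<nu> x) (M \<Otimes>\<^sub>M borel) (\<lambda>y. (x, y))) \<in> M \<rightarrow>\<^sub>M prob_algebra (M \<Otimes>\<^sub>M borel)"
    using \<nu> by (intro measurable_distr_prob_space2[where M = borel]) auto
  then have *: "round_kernel M A \<nu> t \<in> PiM {0..<t} (\<lambda>_. M \<Otimes>\<^sub>M borel) \<rightarrow>\<^sub>M prob_algebra (M \<Otimes>\<^sub>M borel)" for t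
    unfolding round_kernel_def[abs_def] using A
    by (intro measurable_bind_prob_space[where N = M]) (auto simp: bandit_algorithm_def)
  show ?thesis
    by (rule Ionescu_Tulcea.intro, rule measurable_prob_algebraD[OF *])
       (drule measurable_space[OF *], simp add: space_prob_algebra)
qed

end

theory Submission
  imports Defs "HOL-Library.Discrete_Functions"
begin

text \<open>The completion of \<open>X\<close> is compact iff \<open>X\<close> is totally bounded.

  If \<open>X\<close> is totally bounded, it has a sequence of arms whose initial segments are \<open>1/(k+1)\<close>-nets.
  Explore every arm of it infinitely often, but only in the rounds that are perfect squares, and
  play an arm with the best empirical mean among a slowly growing initial segment in all others. By
  Chebyshev-type second-moment bounds the expected gap in the exploitation rounds tends to \<open>0\<close> at a
  rate independent of the instance, so the regret is sublinear by Cesaro averaging.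

  Otherwise there are infinitely many disjoint balls of a fixed radius \<open>r\<close>. Hide in some of them
  needles of heights \<open>r (1 - 2^(-l-1))\<close>, with deterministic rewards. A given algorithm enters all but
  finitely many of the balls before a given time with arbitrarily small probability, hence the balls
  can be chosen one after another such that up to time \<open>T\<^sub>j\<close> the needles \<open>j, j+1, \<dots>\<close> are likely to be
  missed; the regret at \<open>T\<^sub>j\<close> is then at least a constant times \<open>2^(-j) T\<^sub>j\<close>. As \<open>f\<close> is sublinear, the times
  \<open>T\<^sub>j\<close> can be fixed in advance such that this exceeds every multiple of \<open>f (T\<^sub>j)\<close>.\<close>

section \<open>Total boundedness\<close>

text \<open>The completion is complete, so its compactness amounts to total boundedness, and a set
  is totally bounded iff its closure is. The dense copy of the space under
  \<open>completion_embed\<close> is isometric to it, so finite nets can be carried over in both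
  directions.\<close>

lemma (in Metric_space) compact_completion_iff_mtotally_bounded:
  "compact_space (Metric_space.mtopology (completion_space M d) (completion_dist M d)) \<longleftrightarrow>
     mtotally_bounded M"
proof -
  interpret C: Metric_space "completion_space M d" "completion_dist M d"
    by (rule Metric_space_completion)
  have sub: "completion_embed ` M \<subseteq> completion_space M d"
    using completion_embed_in by blast
  have "C.mtotally_bounded (completion_embed ` M) \<longleftrightarrow> mtotally_bounded M"
  proof
    assume L: "C.mtotally_bounded (completion_embed ` M)"
    show "mtotally_bounded M"
      unfolding mtotally_bounded_def
    proof (intro allI impI)
      fix e :: real assume "e > 0"
      then obtain K where K: "finite K" "K \<subseteq> completion_embed ` M"
        "completion_embed ` M \<subseteq> (\<Union>x\<in>K. C.mball x e)"
        using L unfolding C.mtotally_bounded_def by meson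
      then obtain K' where K': "finite K'" "K' \<subseteq> M" "K = completion_embed ` K'"
        by (meson finite_subset_image)
      have "M \<subseteq> (\<Union>x\<in>K'. mball x e)"
      proof
        fix y assume y: "y \<in> M"
        then obtain x where "x \<in> K'" "completion_embed y \<in> C.mball (completion_embed x) e"
          using K K' by blast
        then show "y \<in> (\<Union>x\<in>K'. mball x e)"
          using y K'(2) completion_dist_embed[of x y] by (auto intro!: bexI[of _ x])
      qed
      with K' show "\<exists>K. finite K \<and> K \<subseteq> M \<and> M \<subseteq> (\<Union>x\<in>K. mball x e)" by blast
    qed
  next
    assume R: "mtotally_bounded M"
    show "C.mtotally_bounded (completion_embed ` M)"
      unfolding C.mtotally_bounded_def
    proof (intro allI impI)
      fix e :: real assume "e > 0"
      then obtain K where K: "finite K" "K \<subseteq> M" "M \<subseteq> (\<Union>x\<in>K. mball x e)"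
        using R unfolding mtotally_bounded_def by meson
      have "completion_embed ` M \<subseteq> (\<Union>x\<in>completion_embed ` K. C.mball x e)"
      proof (rule image_subsetI)
        fix y assume y: "y \<in> M"
        then obtain x where "x \<in> K" "y \<in> mball x e" using K by blast
        then show "completion_embed y \<in> (\<Union>x\<in>completion_embed ` K. C.mball x e)"
          using completion_dist_embed[of x y] completion_embed_in by (auto intro!: bexI[of _ x])
      qed
      with K show "\<exists>K. finite K \<and> K \<subseteq> completion_embed ` M \<and> completion_embed ` M \<subseteq> (\<Union>x\<in>K. C.mball x e)"
        by (intro exI[of _ "completion_embed ` K"]) auto
    qed
  qed
  then show ?thesis
    using C.mtotally_bounded_closure_of_eq[OF sub] completion_embed_dense mcomplete_completion
    by (simp add: C.compact_space_eq_mcomplete_mtotally_bounded)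
qed

text \<open>All finite nets of radius \<open>1 / (k + 1)\<close> are enumerated in a single
  sequence; \<open>N k\<close> is taken so large that the first \<open>N k\<close> entries contain
  the whole \<open>k\<close>-th net. The algorithm will work with such initial segments.\<close>

lemma (in Metric_space) dense_sequence_if_mtotally_bounded:
  assumes tb: "mtotally_bounded M" and ne: "M \<noteq> {}"
  obtains a :: "nat \<Rightarrow> 'a" and N :: "nat \<Rightarrow> nat" where "range a \<subseteq> M"
    "\<And>k y. y \<in> M \<Longrightarrow> \<exists>i<N k. d y (a i) < 1 / real (Suc k)"
proof -
  have "\<forall>k. \<exists>K. finite K \<and> K \<subseteq> M \<and> M \<subseteq> (\<Union>x\<in>K. mball x (1 / real (Suc k)))"
    using tb unfolding mtotally_bounded_def by simp
  then obtain K where K: "\<And>k. finite (K k)" "\<And>k. K k \<subseteq> M"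
    "\<And>k. M \<subseteq> (\<Union>x\<in>K k. mball x (1 / real (Suc k)))"
    by metis
  define a where "a = from_nat_into (\<Union>k. K k)"
  have cU: "countable (\<Union>k. K k)" using K(1) by (auto intro: countable_finite)
  have neU: "(\<Union>k. K k) \<noteq> {}" using K(3)[of 0] ne by auto
  have ra: "range a = (\<Union>k. K k)"
    unfolding a_def using range_from_nat_into[OF neU cU] .
  have "\<exists>n. K k \<subseteq> a ` {..<n}" for k
  proof -
    have "K k \<subseteq> range a" using ra by blast
    then obtain I where I: "finite I" "K k = a ` I"
      by (metis K(1) finite_subset_image subset_UNIV)
    then obtain n where "I \<subseteq> {..<n}" using finite_nat_bounded by blast
    with I show ?thesis by blast
  qed
  then obtain N where N: "\<And>k. K k \<subseteq> a ` {..<N k}" by metis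
  show thesis
  proof
    show "range a \<subseteq> M" using ra K(2) by blast
    fix k y assume "y \<in> M"
    then obtain x where x: "x \<in> K k" "y \<in> mball x (1 / real (Suc k))" using K(3) by blast
    with N obtain i where "i < N k" "x = a i" by blast
    with x show "\<exists>i<N k. d y (a i) < 1 / real (Suc k)" by (auto simp: commute)
  qed
qed

text \<open>Greedy choice: for some radius \<open>e\<close> no finite set is an
  \<open>e\<close>-net, so there is always a further point at distance at least \<open>e\<close>
  from all points chosen so far.\<close>

lemma (in Metric_space) separated_sequence_if_not_mtotally_bounded:
  assumes "\<not> mtotally_bounded M"
  obtains e :: real and a :: "nat \<Rightarrow> 'a" where "e > 0" "range a \<subseteq> M" "\<And>i j. i \<noteq> j \<Longrightarrow> e \<le> d (a i) (a j)"
proof -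
  obtain e where e: "e > 0" "\<And>K. finite K \<Longrightarrow> K \<subseteq> M \<Longrightarrow> \<exists>x\<in>M. \<forall>y\<in>K. e \<le> d y x"
    using assms unfolding mtotally_bounded_def subset_iff in_mball UN_iff
    by (smt (verit) in_mball subset_iff)
  have "\<exists>a. \<forall>n::nat. a n \<in> M \<and> (\<forall>i<n. e \<le> d (a i) (a n))"
  proof -
    \<comment> \<open>The recursive choice must succeed for every \<open>f\<close>, also for one
      that leaves \<open>M\<close>; hence the guard on the earlier values, which the induction below
      removes.\<close>
    have "\<exists>f. \<forall>n::nat. (\<forall>i<n. f i \<in> M) \<longrightarrow> f n \<in> M \<and> (\<forall>i<n. e \<le> d (f i) (f n))"
    proof (rule dependent_wf_choice[OF wf_less_than, where
          P = "\<lambda>f n r. (\<forall>i<n. f i \<in> M) \<longrightarrow> r \<in> M \<and> (\<forall>i<n. e \<le> d (f i) r)"])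
      fix n :: nat and f :: "nat \<Rightarrow> 'a"
      show "\<exists>r. (\<forall>i<n. f i \<in> M) \<longrightarrow> r \<in> M \<and> (\<forall>i<n. e \<le> d (f i) r)"
        using e(2)[of "f ` {..<n}"] by auto
    qed auto
    then obtain a where a: "\<And>n::nat. (\<forall>i<n. a i \<in> M) \<longrightarrow> a n \<in> M \<and> (\<forall>i<n. e \<le> d (a i) (a n))"
      by (elim exE) blast
    have "a n \<in> M" for n
      by (induction n rule: less_induct) (use a in blast)
    with a show ?thesis by blast
  qed
  then obtain a where a: "\<And>n::nat. a n \<in> M" "\<And>i n. i < n \<Longrightarrow> e \<le> d (a i) (a n)" by metis
  show thesis
  proof
    fix i j :: nat assume "i \<noteq> j"
    then show "e \<le> d (a i) (a j)" using a(2) commute by (metis linorder_neqE_nat)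
  qed (use a e in auto)
qed

section \<open>Laws of histories\<close>

lemma measurable_round_arm:
  "(s::nat) < u \<Longrightarrow> (\<lambda>h. fst (h s)) \<in> PiM {0..<u} (\<lambda>_. M \<Otimes>\<^sub>M N) \<rightarrow>\<^sub>M M"
  using measurable_compose[OF measurable_component_singleton[of s "{0..<u}" "\<lambda>_. M \<Otimes>\<^sub>M N"] measurable_fst]
  by simp

lemma measurable_round_reward:
  "(s::nat) < u \<Longrightarrow> (\<lambda>h. snd (h s)) \<in> PiM {0..<u} (\<lambda>_. M \<Otimes>\<^sub>M N) \<rightarrow>\<^sub>M N"
  using measurable_compose[OF measurable_component_singleton[of s "{0..<u}" "\<lambda>_. M \<Otimes>\<^sub>M N"] measurable_snd]
  by simp

locale bandit_run =
  fixes M :: "'a measure" and A :: "nat \<Rightarrow> (nat \<Rightarrow> 'a \<times> real) \<Rightarrow> 'a measure"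
    and \<nu> :: "'a \<Rightarrow> real measure"
  assumes algorithm: "bandit_algorithm M A"
    and reward_kernel [measurable]: "\<nu> \<in> M \<rightarrow>\<^sub>M prob_algebra borel"
begin

abbreviation histories :: "nat \<Rightarrow> (nat \<Rightarrow> 'a \<times> real) measure" where
  "histories t \<equiv> PiM {0..<t} (\<lambda>_. M \<Otimes>\<^sub>M borel)"

abbreviation law :: "nat \<Rightarrow> (nat \<Rightarrow> 'a \<times> real) measure" where
  "law \<equiv> history_law M A \<nu>"

sublocale IT: Ionescu_Tulcea "round_kernel M A \<nu>" "\<lambda>_. M \<Otimes>\<^sub>M borel"
  by (rule Ionescu_Tulcea_round_kernel[OF algorithm reward_kernel])

lemma algorithm_measurable [measurable]: "A t \<in> histories t \<rightarrow>\<^sub>M prob_algebra M"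
  using algorithm by (simp add: bandit_algorithm_def)

lemma start_in: "(\<lambda>_. undefined) \<in> space (histories 0)"
  by (simp add: space_PiM)

lemma sets_law [measurable_cong, simp]: "sets (law t) = sets (histories t)"
  using IT.sets_C[OF start_in, of t] by (simp add: history_law_def)

lemma space_law: "space (law t) = space (histories t)"
  by (rule sets_eq_imp_space_eq) simp

lemma prob_space_law: "prob_space (law t)"
  using IT.prob_space_C[OF start_in, of t] by (simp add: history_law_def)

lemma law_0: "law 0 = return (histories 0) (\<lambda>_. undefined)"
  by (simp add: history_law_def)

lemma A_in:
  assumes "h \<in> space (histories t)"
  shows "sets (A t h) = sets M" "prob_space (A t h)"
  using measurable_space[OF algorithm_measurable assms] by (auto simp: space_prob_algebra)

lemma \<nu>_in:
  assumes "x \<in> space M"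
  shows "sets (\<nu> x) = sets borel" "prob_space (\<nu> x)"
  using measurable_space[OF reward_kernel assms] by (auto simp: space_prob_algebra)

lemma measurable_extend [measurable]:
  assumes "f \<in> N \<rightarrow>\<^sub>M histories t" "g \<in> N \<rightarrow>\<^sub>M M \<Otimes>\<^sub>M borel"
  shows "(\<lambda>z. (f z)(t := g z)) \<in> N \<rightarrow>\<^sub>M histories (Suc t)"
  using assms by (intro measurable_fun_upd[where J = "{0..<t}"]) auto

text \<open>This peels off the last round: the past from its law, then the arm, then the reward.
  Each monadic bind in the construction of the law becomes an iterated integral. Nonnegative
  integrals avoid all integrability conditions.\<close>

lemma nn_integral_law_Suc:
  assumes F [measurable]: "F \<in> borel_measurable (histories (Suc t))"
  shows "(\<integral>\<^sup>+h. F h \<partial>law (Suc t)) =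
    (\<integral>\<^sup>+h. (\<integral>\<^sup>+x. (\<integral>\<^sup>+y. F (h(t := (x, y))) \<partial>\<nu> x) \<partial>A t h) \<partial>law t)"
proof -
  have "(\<integral>\<^sup>+h. F h \<partial>law (Suc t)) = (\<integral>\<^sup>+h. (\<integral>\<^sup>+h'. F h' \<partial>IT.eP t h) \<partial>law t)"
    unfolding history_law_def IT.C.simps add_0
    by (rule nn_integral_bind[OF F])
       (use IT.measurable_eP[of t] sets_law[of t] in \<open>simp add: history_law_def cong: measurable_cong_sets\<close>)
  also have "\<dots> = (\<integral>\<^sup>+h. (\<integral>\<^sup>+x. (\<integral>\<^sup>+y. F (h(t := (x, y))) \<partial>\<nu> x) \<partial>A t h) \<partial>law t)"
  proof (rule nn_integral_cong)
    fix h assume "h \<in> space (law t)"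
    then have h [measurable]: "h \<in> space (histories t)" by (simp add: space_law)
    note [measurable_cong] = A_in(1)[OF h]
    have K: "(\<lambda>x. distr (\<nu> x) (M \<Otimes>\<^sub>M borel) (\<lambda>y. (x, y))) \<in> M \<rightarrow>\<^sub>M prob_algebra (M \<Otimes>\<^sub>M borel)"
      by (intro measurable_distr_prob_space2[where M = borel]) auto
    have Fh: "(\<lambda>z. F (h(t := z))) \<in> borel_measurable (M \<Otimes>\<^sub>M borel)"
      by (rule measurable_compose[OF measurable_extend F]) auto
    have "(\<integral>\<^sup>+h'. F h' \<partial>IT.eP t h) = (\<integral>\<^sup>+z. F (h(t := z)) \<partial>round_kernel M A \<nu> t h)"
      by (rule IT.nn_integral_eP[OF h F])
    also have "\<dots> = (\<integral>\<^sup>+x. (\<integral>\<^sup>+z. F (h(t := z)) \<partial>distr (\<nu> x) (M \<Otimes>\<^sub>M borel) (\<lambda>y. (x, y))) \<partial>A t h)"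
      unfolding round_kernel_def
      by (rule nn_integral_bind[OF Fh])
         (use measurable_prob_algebraD[OF K] A_in(1)[OF h] in \<open>simp cong: measurable_cong_sets\<close>)
    also have "\<dots> = (\<integral>\<^sup>+x. (\<integral>\<^sup>+y. F (h(t := (x, y))) \<partial>\<nu> x) \<partial>A t h)"
    proof (rule nn_integral_cong)
      fix x assume "x \<in> space (A t h)"
      then have x: "x \<in> space M" using sets_eq_imp_space_eq[OF A_in(1)[OF h]] by simp
      have [measurable_cong]: "sets (\<nu> x) = sets borel" by (rule \<nu>_in(1)[OF x])
      show "(\<integral>\<^sup>+z. F (h(t := z)) \<partial>distr (\<nu> x) (M \<Otimes>\<^sub>M borel) (\<lambda>y. (x, y))) =
            (\<integral>\<^sup>+y. F (h(t := (x, y))) \<partial>\<nu> x)"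
        using Fh x by (subst nn_integral_distr) auto
    qed
    finally show "(\<integral>\<^sup>+h'. F h' \<partial>IT.eP t h) = (\<integral>\<^sup>+x. (\<integral>\<^sup>+y. F (h(t := (x, y))) \<partial>\<nu> x) \<partial>A t h)" .
  qed
  finally show ?thesis .
qed

lemma nn_integral_law_Suc_fixed_arm:
  assumes A: "\<And>h. h \<in> space (histories t) \<Longrightarrow> A t h = return M (g h)"
    and g [measurable]: "g \<in> histories t \<rightarrow>\<^sub>M M"
    and F [measurable]: "F \<in> borel_measurable (histories (Suc t))"
  shows "(\<integral>\<^sup>+h. F h \<partial>law (Suc t)) = (\<integral>\<^sup>+h. (\<integral>\<^sup>+y. F (h(t := (g h, y))) \<partial>\<nu> (g h)) \<partial>law t)"
  unfolding nn_integral_law_Suc[OF F]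
proof (rule nn_integral_cong)
  fix h assume "h \<in> space (law t)"
  then have h [measurable]: "h \<in> space (histories t)" by (simp add: space_law)
  have "(\<lambda>p. F (h(t := p))) \<in> borel_measurable (M \<Otimes>\<^sub>M borel)"
    by (rule measurable_compose[OF measurable_extend F]) auto
  then have "(\<lambda>x. \<integral>\<^sup>+y. F (h(t := (x, y))) \<partial>\<nu> x) \<in> borel_measurable M"
    by (intro nn_integral_measurable_subprob_algebra2[where N = borel]
        measurable_prob_algebraD[OF reward_kernel]) (simp add: case_prod_unfold)
  then show "(\<integral>\<^sup>+x. (\<integral>\<^sup>+y. F (h(t := (x, y))) \<partial>\<nu> x) \<partial>A t h) = (\<integral>\<^sup>+y. F (h(t := (g h, y))) \<partial>\<nu> (g h))"
    using measurable_space[OF g h] by (simp add: A[OF h] nn_integral_return)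
qed

text \<open>A functional that ignores round \<open>t\<close> is constant for the two inner
  integrals, which are taken against probability measures.\<close>

lemma nn_integral_law_Suc_past:
  assumes F [measurable]: "F \<in> borel_measurable (histories (Suc t))"
    and eq: "\<And>h z. F (h(t := z)) = F h"
  shows "(\<integral>\<^sup>+h. F h \<partial>law (Suc t)) = (\<integral>\<^sup>+h. F h \<partial>law t)"
  unfolding nn_integral_law_Suc[OF F] eq
proof (rule nn_integral_cong)
  fix h assume "h \<in> space (law t)"
  then have h: "h \<in> space (histories t)" by (simp add: space_law)
  have "(\<integral>\<^sup>+y. F h \<partial>\<nu> x) = F h" if "x \<in> space (A t h)" for x
    using that \<nu>_in(2)[of x] sets_eq_imp_space_eq[OF A_in(1)[OF h]]
    by (simp add: prob_space.emeasure_space_1)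
  then have "(\<integral>\<^sup>+x. (\<integral>\<^sup>+y. F h \<partial>\<nu> x) \<partial>A t h) = (\<integral>\<^sup>+x. F h \<partial>A t h)"
    by (intro nn_integral_cong) 
  then show "(\<integral>\<^sup>+x. (\<integral>\<^sup>+y. F h \<partial>\<nu> x) \<partial>A t h) = F h"
    using A_in(2)[OF h] by (simp add: prob_space.emeasure_space_1)
qed

end

section \<open>Second moments of centered rewards\<close>

text \<open>Expand the square: the cross term vanishes because \<open>m\<close> is the mean, and
  \<open>(y - m)\<^sup>2\<close> is at most 1 because both numbers lie in the unit interval.\<close>

lemma nn_integral_shifted_square_le:
  fixes N :: "real measure"
  assumes "prob_space N" and sets: "sets N = sets borel"
    and supp: "emeasure N {0..1} = 1" and mean: "(\<integral>y. y \<partial>N) = m"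
  shows "(\<integral>\<^sup>+y. ennreal ((z + (y - m))\<^sup>2) \<partial>N) \<le> ennreal (z\<^sup>2 + 1)"
proof -
  interpret prob_space N by fact
  have [measurable_cong]: "sets N = sets borel" by fact
  have AE01: "AE y in N. y \<in> {0..1}"
    using supp by (intro AE_prob_1) (simp add: measure_def)
  have i1: "integrable N (\<lambda>y. y)"
    by (rule integrable_const_bound[of _ 1]) (use AE01 in auto)
  have m: "0 \<le> m" "m \<le> 1"
    unfolding mean[symmetric] using AE01 integral_nonneg_AE[of "\<lambda>y. y" N]
      integral_mono_AE[OF i1 integrable_const[of 1]] by (auto simp: prob_space)
  have sq: "AE y in N. (y - m)\<^sup>2 \<le> 1"
    using AE01 by eventually_elim (use m in \<open>auto simp: abs_square_le_1\<close>)
  have i2: "integrable N (\<lambda>y. (y - m)\<^sup>2)"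
    by (rule integrable_const_bound[of _ 1]) (use sq in auto)
  have e: "(z + (y - m))\<^sup>2 = z\<^sup>2 + 2 * z * (y - m) + (y - m)\<^sup>2" for y
    by (simp add: power2_eq_square algebra_simps)
  have i3: "integrable N (\<lambda>y. (z + (y - m))\<^sup>2)"
    unfolding e using i1 i2 by (intro Bochner_Integration.integrable_add) auto
  have "(\<integral>y. (z + (y - m))\<^sup>2 \<partial>N) = z\<^sup>2 + (\<integral>y. (y - m)\<^sup>2 \<partial>N)"
    unfolding e using i1 i2 mean by (simp add: prob_space)
  also have "\<dots> \<le> z\<^sup>2 + 1"
    using integral_mono_AE[OF i2 integrable_const[of 1]] sq by (simp add: prob_space)
  finally show ?thesis
    using nn_integral_eq_integral[OF i3] by (simp add: ennreal_leI del: ennreal_plus)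
qed

context bandit_run
begin

text \<open>The rounds in \<open>S\<close> and their arm are fixed in advance, so the sums of
  centered rewards form a martingale: a round in \<open>S\<close> adds at most 1 to the second
  moment, any other round leaves the sum unchanged. No independence argument is required.\<close>

lemma second_moment_fixed_arm_le:
  assumes arm: "\<And>s h. s \<in> S \<Longrightarrow> h \<in> space (histories s) \<Longrightarrow> A s h = return M a"
    and a: "a \<in> space M" "emeasure (\<nu> a) {0..1} = 1" "(\<integral>y. y \<partial>\<nu> a) = m"
  shows "(\<integral>\<^sup>+h. ennreal ((\<Sum>s\<in>S \<inter> {..<t}. snd (h s) - m)\<^sup>2) \<partial>law t) \<le> ennreal (card (S \<inter> {..<t}))"
proof (induction t)
  case 0
  then show ?case by simp
next
  case (Suc t)
  let ?Z = "\<lambda>t h. \<Sum>s\<in>S \<inter> {..<t}. snd ((h :: nat \<Rightarrow> 'a \<times> real) s) - m"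
  have Z [measurable]: "?Z t \<in> borel_measurable (histories u)" if "t \<le> u" for t u
    using that by (intro borel_measurable_sum borel_measurable_diff measurable_round_reward) auto
  show ?case
  proof (cases "t \<in> S")
    case False
    then have S: "S \<inter> {..<Suc t} = S \<inter> {..<t}" by (auto simp: less_Suc_eq)
    have upd: "?Z t (h(t := z)) = ?Z t h" for h z
      by (rule sum.cong) auto
    show ?thesis
      unfolding S by (subst nn_integral_law_Suc_past) (use upd Suc Z[of t "Suc t"] in auto)
  next
    case True
    then have S: "S \<inter> {..<Suc t} = insert t (S \<inter> {..<t})" by (auto simp: less_Suc_eq)
    have upd: "?Z (Suc t) (h(t := z)) = ?Z t h + (snd z - m)" for h z
    proof -
      have "?Z t (h(t := z)) = ?Z t h"
        by (rule sum.cong) auto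
      then show ?thesis unfolding S by simp
    qed
    have "(\<integral>\<^sup>+h. ennreal ((?Z (Suc t) h)\<^sup>2) \<partial>law (Suc t)) =
        (\<integral>\<^sup>+h. (\<integral>\<^sup>+y. ennreal ((?Z t h + (y - m))\<^sup>2) \<partial>\<nu> a) \<partial>law t)"
      using nn_integral_law_Suc_fixed_arm[of t "\<lambda>_. a" "\<lambda>h. ennreal ((?Z (Suc t) h)\<^sup>2)"]
        True arm a(1) Z[of "Suc t" "Suc t"] unfolding upd by simp
    also have "\<dots> \<le> (\<integral>\<^sup>+h. ennreal ((?Z t h)\<^sup>2 + 1) \<partial>law t)"
      using a \<nu>_in[OF a(1)] by (intro nn_integral_mono nn_integral_shifted_square_le) auto
    also have "\<dots> = (\<integral>\<^sup>+h. ennreal ((?Z t h)\<^sup>2) \<partial>law t) + 1"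
      using Z[of t t] prob_space.emeasure_space_1[OF prob_space_law[of t]]
      by (simp add: ennreal_plus nn_integral_add)
    also have "\<dots> \<le> ennreal (card (S \<inter> {..<t})) + 1"
      using Suc by (intro add_right_mono)
    also have "\<dots> = ennreal (card (S \<inter> {..<Suc t}))"
      unfolding S by (simp add: add.commute)
    finally show ?thesis .
  qed
qed

text \<open>Payoffs lie in the unit interval, so the recursion can be derived with nonnegative
  integrals and brought back to the Bochner integral. It lets the regret be bounded one round at a
  time.\<close>

lemma expected_reward_Suc:
  fixes \<mu> :: "'a \<Rightarrow> real"
  assumes A: "\<And>h. h \<in> space (histories t) \<Longrightarrow> A t h = return M (g h)"
    and g [measurable]: "g \<in> histories t \<rightarrow>\<^sub>M M"
    and \<mu> [measurable]: "\<mu> \<in> borel_measurable M" and \<mu>01: "\<And>x. x \<in> space M \<Longrightarrow> \<mu> x \<in> {0..1}"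
  shows "(\<integral>h. (\<Sum>s<Suc t. \<mu> (fst (h s))) \<partial>law (Suc t)) =
    (\<integral>h. (\<Sum>s<t. \<mu> (fst (h s))) \<partial>law t) + (\<integral>h. \<mu> (g h) \<partial>law t)"
proof -
  interpret P: prob_space "law t" by (rule prob_space_law)
  let ?G = "\<lambda>t h. \<Sum>s<t. \<mu> (fst ((h :: nat \<Rightarrow> 'a \<times> real) s))"
  have G [measurable]: "?G t \<in> borel_measurable (histories u)" if "t \<le> u" for t u
    using that by (intro borel_measurable_sum measurable_compose[OF measurable_round_arm \<mu>]) auto
  have comp: "\<mu> (fst (h s)) \<in> {0..1}" if "h \<in> space (histories u)" "s < u" for h s u
    using \<mu>01 measurable_space[OF measurable_round_arm[OF that(2)] that(1)] by simp
  have G_bd: "0 \<le> ?G u h" "?G u h \<le> real u" if "h \<in> space (histories u)" for h u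
    using comp[OF that] sum_bounded_above[of "{..<u}" "\<lambda>s. \<mu> (fst (h s))" 1] by (auto intro!: sum_nonneg)
  have g01: "\<mu> (g h) \<in> {0..1}" if "h \<in> space (histories t)" for h
    using \<mu>01 measurable_space[OF g that] by blast
  have iG: "integrable (law u) (?G u)" for u
  proof -
    interpret prob_space "law u" by (rule prob_space_law)
    show ?thesis
      by (rule integrable_const_bound[of _ "real u"]) (use G_bd G[of u u] in \<open>auto simp: space_law\<close>)
  qed
  have ig: "integrable (law t) (\<lambda>h. \<mu> (g h))"
    by (rule P.integrable_const_bound[of _ 1]) (use g01 in \<open>auto simp: space_law\<close>)
  have "ennreal (\<integral>h. ?G (Suc t) h \<partial>law (Suc t)) = (\<integral>\<^sup>+h. ennreal (?G (Suc t) h) \<partial>law (Suc t))"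
    using G_bd by (intro nn_integral_eq_integral[symmetric] iG) (auto simp: space_law simp del: sum.lessThan_Suc)
  also have "\<dots> = (\<integral>\<^sup>+h. (\<integral>\<^sup>+y. ennreal (?G (Suc t) (h(t := (g h, y)))) \<partial>\<nu> (g h)) \<partial>law t)"
    using G[of "Suc t" "Suc t"] by (intro nn_integral_law_Suc_fixed_arm A g) auto
  also have "\<dots> = (\<integral>\<^sup>+h. ennreal (?G t h + \<mu> (g h)) \<partial>law t)"
  proof (rule nn_integral_cong)
    fix h assume "h \<in> space (law t)"
    then have "g h \<in> space M" using measurable_space[OF g] by (simp add: space_law)
    then interpret N: prob_space "\<nu> (g h)" by (rule \<nu>_in)
    have "?G (Suc t) (h(t := (g h, y))) = ?G t h + \<mu> (g h)" for y by simp
    then show "(\<integral>\<^sup>+y. ennreal (?G (Suc t) (h(t := (g h, y)))) \<partial>\<nu> (g h)) = ennreal (?G t h + \<mu> (g h))"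
      by (simp add: N.emeasure_space_1 del: sum.lessThan_Suc)
  qed
  also have "\<dots> = ennreal (\<integral>h. ?G t h + \<mu> (g h) \<partial>law t)"
    using G_bd g01 by (intro nn_integral_eq_integral Bochner_Integration.integrable_add iG ig)
      (auto simp: space_law)
  finally have "(\<integral>h. ?G (Suc t) h \<partial>law (Suc t)) = (\<integral>h. ?G t h + \<mu> (g h) \<partial>law t)"
    using G_bd g01 by (subst (asm) ennreal_inj)
      (auto intro!: integral_nonneg_AE simp: space_law simp del: sum.lessThan_Suc)
  also have "\<dots> = (\<integral>h. ?G t h \<partial>law t) + (\<integral>h. \<mu> (g h) \<partial>law t)"
    by (rule Bochner_Integration.integral_add[OF iG ig])
  finally show ?thesis .
qed

end

section \<open>Explore and exploit\<close>

lemma cesaro_null: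
  fixes b :: "nat \<Rightarrow> real"
  assumes "b \<longlonglongrightarrow> 0"
  shows "(\<lambda>t. (\<Sum>s<t. b s) / real t) \<longlonglongrightarrow> 0"
proof (rule LIMSEQ_I)
  fix e :: real assume e: "e > 0"
  obtain n where n: "\<And>s. s \<ge> n \<Longrightarrow> \<bar>b s\<bar> < e / 2"
    using LIMSEQ_D[OF assms, of "e/2"] e by auto
  define c where "c = (\<Sum>s<n. \<bar>b s\<bar>)"
  have c0: "c \<ge> 0" unfolding c_def by (simp add: sum_nonneg)
  \<comment> \<open>Beyond \<open>m\<close> the fixed head \<open>c\<close> of the sum is less than
    half of the allowed \<open>t * e\<close>.\<close>
  obtain m :: nat where m: "2 * c / e < real m" using reals_Archimedean2 by blast
  have "\<bar>(\<Sum>s<t. b s) / real t\<bar> < e" if t: "t \<ge> Suc (max m n)" for t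
  proof -
    have "\<bar>\<Sum>s<t. b s\<bar> \<le> (\<Sum>s<t. \<bar>b s\<bar>)" by (rule sum_abs)
    also have "\<dots> \<le> (\<Sum>s<t. (if s < n then \<bar>b s\<bar> else 0) + e / 2)"
      using n e by (intro sum_mono) (auto simp: not_less intro: less_imp_le)
    also have "\<dots> = (\<Sum>s<t. if s < n then \<bar>b s\<bar> else 0) + real t * (e / 2)"
      by (simp add: sum.distrib)
    also have "(\<Sum>s<t. if s < n then \<bar>b s\<bar> else 0) = c"
    proof -
      have "{..<t} \<inter> {s. s < n} = {..<n}" using t by auto
      then show ?thesis unfolding c_def by (simp add: sum.If_cases)
    qed
    also have "c < real t * (e / 2)"
    proof -
      have "2 * c / e < real t" using m t by linarith
      then show ?thesis using e by (simp add: field_simps)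
    qed
    finally have "\<bar>\<Sum>s<t. b s\<bar> < real t * e" by (simp add: field_simps)
    then show ?thesis using t by (simp add: abs_divide pos_divide_less_eq mult.commute)
  qed
  then show "\<exists>no. \<forall>t\<ge>no. norm ((\<Sum>s<t. b s) / real t - 0) < e"
    by (intro exI[of _ "Suc (max m n)"]) simp
qed

section \<open>Rounds reserved for exploration\<close>

text \<open>In round \<open>n\<^sup>2\<close> the arm index is the first component of the pair coded
  by \<open>n\<close>; since the second component is free, every index recurs infinitely
  often.\<close>

definition exploration_schedule :: "nat \<Rightarrow> nat option" where
  "exploration_schedule s =
     (if (floor_sqrt s)\<^sup>2 = s then Some (fst (prod_decode (floor_sqrt s))) else None)"

lemma infinite_exploration_rounds: "infinite {s. exploration_schedule s = Some i}"
proof -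
  have "inj (\<lambda>j. (prod_encode (i, j))\<^sup>2)"
    by (auto simp: inj_def)
  moreover have "range (\<lambda>j. (prod_encode (i, j))\<^sup>2) \<subseteq> {s. exploration_schedule s = Some i}"
    by (auto simp: exploration_schedule_def)
  ultimately show ?thesis
    using range_inj_infinite infinite_super by blast
qed

text \<open>There are at most \<open>sqrt t + 1\<close> perfect squares below
  \<open>t\<close>.\<close>

lemma exploration_rounds_sparse:
  "(\<lambda>t. real (card {s. s < t \<and> exploration_schedule s \<noteq> None}) / real t) \<longlonglongrightarrow> 0"
proof (rule Lim_null_comparison)
  have "real (card {s. s < t \<and> exploration_schedule s \<noteq> None}) \<le> sqrt (real t) + 1" for t
  proof -
    have "{s. s < t \<and> exploration_schedule s \<noteq> None} \<subseteq> (\<lambda>n. n\<^sup>2) ` {..floor_sqrt t}"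
    proof
      fix s assume "s \<in> {s. s < t \<and> exploration_schedule s \<noteq> None}"
      then have "s < t" "(floor_sqrt s)\<^sup>2 = s"
        by (auto simp: exploration_schedule_def split: if_splits)
      then show "s \<in> (\<lambda>n. n\<^sup>2) ` {..floor_sqrt t}"
        using mono_floor_sqrt by (intro image_eqI[of _ _ "floor_sqrt s"]) (auto simp: mono_def)
    qed
    then have "card {s. s < t \<and> exploration_schedule s \<noteq> None} \<le> card ((\<lambda>n. n\<^sup>2) ` {..floor_sqrt t})"
      by (intro card_mono) auto
    also have "\<dots> \<le> floor_sqrt t + 1"
      using card_image_le[of "{..floor_sqrt t}" "\<lambda>n. n\<^sup>2"] by simp
    finally have "real (card {s. s < t \<and> exploration_schedule s \<noteq> None}) \<le> real (floor_sqrt t) + 1" by linarith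
    also have "real (floor_sqrt t) \<le> sqrt (real t)"
      by (rule real_le_rsqrt) (metis floor_sqrt_power2_le of_nat_le_iff of_nat_power)
    finally show ?thesis by simp
  qed
  then show "\<forall>\<^sub>F t in sequentially. norm (real (card {s. s < t \<and> exploration_schedule s \<noteq> None}) / real t)
      \<le> (sqrt (real t) + 1) / real t"
    by (intro always_eventually) (auto intro!: divide_right_mono)
  have "(\<lambda>t. 1 / sqrt (real t) + 1 / real t) \<longlonglongrightarrow> 0 + 0"
    by (intro tendsto_add lim_1_over_n tendsto_divide_0[OF tendsto_const]
      filterlim_at_top_imp_at_infinity filterlim_compose[OF sqrt_at_top filterlim_real_sequentially])
  moreover have "(sqrt (real t) + 1) / real t = 1 / sqrt (real t) + 1 / real t" for t
    by (simp add: add_divide_distrib sqrt_divide_self_eq inverse_eq_divide)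
  ultimately show "(\<lambda>t. (sqrt (real t) + 1) / real t) \<longlonglongrightarrow> 0" by simp
qed

text \<open>A Lipschitz function is continuous, so preimages of open sets are open for the metric,
  and an arm space contains these sets.\<close>

lemma measurable_payoff:
  assumes "Metric_space X D" "arm_space X D M" and lip: "\<And>x y. x \<in> X \<Longrightarrow> y \<in> X \<Longrightarrow> \<bar>\<mu> x - \<mu> y\<bar> \<le> D x y"
  shows "\<mu> \<in> borel_measurable M"
proof (rule borel_measurableI)
  interpret Metric_space X D by fact
  fix S :: "real set" assume S: "open S"
  have "openin mtopology (\<mu> -` S \<inter> X)"
    unfolding openin_mtopology
  proof (intro conjI ballI allI impI)
    fix x assume x: "x \<in> \<mu> -` S \<inter> X"
    then obtain e where e: "e > 0" "\<And>y. \<bar>y - \<mu> x\<bar> < e \<Longrightarrow> y \<in> S"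
      using S by (auto simp: open_dist dist_real_def)
    have "mball x e \<subseteq> \<mu> -` S \<inter> X"
    proof
      fix y assume "y \<in> mball x e"
      then show "y \<in> \<mu> -` S \<inter> X" using lip[of y x] x e(2)[of "\<mu> y"] by (auto simp: commute)
    qed
    with e show "\<exists>r>0. mball x r \<subseteq> \<mu> -` S \<inter> X" by blast
  qed auto
  then show "\<mu> -` S \<inter> space M \<in> sets M"
    using assms(2) by (simp add: arm_space_def)
qed

section \<open>The explore-and-exploit algorithm\<close>

definition exploration_rounds :: "nat \<Rightarrow> nat \<Rightarrow> nat set" where
  "exploration_rounds i t = {s. exploration_schedule s = Some i} \<inter> {..<t}"

lemma finite_exploration_rounds [simp]: "finite (exploration_rounds i t)"
  by (simp add: exploration_rounds_def)

text \<open>Only exploration rounds enter the empirical mean. Their times do not depend on the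
  history, so adaptive choices cannot bias it.\<close>

definition estimate :: "nat \<Rightarrow> nat \<Rightarrow> (nat \<Rightarrow> 'a \<times> real) \<Rightarrow> real" where
  "estimate i t h = (\<Sum>s\<in>exploration_rounds i t. snd (h s)) / real (card (exploration_rounds i t))"

text \<open>Breaking ties by the least index gives a choice that is measurable in the
  history.\<close>

definition best_estimate :: "nat \<Rightarrow> nat \<Rightarrow> (nat \<Rightarrow> 'a \<times> real) \<Rightarrow> nat" where
  "best_estimate n t h = (LEAST i. i < n \<and> (\<forall>j<n. estimate j t h \<le> estimate i t h))"

text \<open>The admissible values contain \<open>k = 0\<close> unconditionally to keep the set nonempty; this is
  harmless because the error bound \<open>3 / (k + 1)\<close> proved for level \<open>k\<close> is trivial at \<open>0\<close>.\<close>

definition level :: "(nat \<Rightarrow> nat) \<Rightarrow> nat \<Rightarrow> nat" where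
  "level N t = Max {k. k \<le> t \<and> (k = 0 \<or> (\<forall>i<N k. (Suc k * N k)\<^sup>2 \<le> card (exploration_rounds i t)))}"

definition explore_exploit_arm :: "(nat \<Rightarrow> 'a) \<Rightarrow> (nat \<Rightarrow> nat) \<Rightarrow> nat \<Rightarrow> (nat \<Rightarrow> 'a \<times> real) \<Rightarrow> 'a" where
  "explore_exploit_arm a N t h =
     a (case exploration_schedule t of Some i \<Rightarrow> i | None \<Rightarrow> best_estimate (N (level N t)) t h)"

text \<open>This depends on the metric space only through \<open>N\<close>, and not on the instance.
  An exploration round is charged the trivial gap 1; the other summand bounds the expected gap of an
  exploitation round.\<close>

definition regret_rate :: "(nat \<Rightarrow> nat) \<Rightarrow> nat \<Rightarrow> real" where
  "regret_rate N t = (\<Sum>s<t. (if exploration_schedule s \<noteq> None then 1 else 0) + 3 / real (Suc (level N s)))"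

lemma level_admissible:
  "level N t = 0 \<or> (\<forall>i<N (level N t). (Suc (level N t) * N (level N t))\<^sup>2 \<le> card (exploration_rounds i t))"
proof -
  let ?K = "{k. k \<le> t \<and> (k = 0 \<or> (\<forall>i<N k. (Suc k * N k)\<^sup>2 \<le> card (exploration_rounds i t)))}"
  have "finite ?K" by (rule finite_subset[of _ "{..t}"]) auto
  then have "level N t \<in> ?K" unfolding level_def by (intro Max_in) auto
  then show ?thesis by blast
qed

text \<open>For fixed \<open>k\<close> only the finitely many arms below \<open>N k\<close> need a
  prescribed number of samples, and each of them is explored infinitely often; so \<open>k\<close>
  is eventually admissible.\<close>

lemma level_tendsto: "filterlim (level N) at_top sequentially"
  unfolding filterlim_at_top
proof
  fix k :: nat
  have "\<exists>T. \<forall>t\<ge>T. (Suc k * N k)\<^sup>2 \<le> card (exploration_rounds i t)" for i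
  proof -
    obtain B where B: "finite B" "card B = (Suc k * N k)\<^sup>2" "B \<subseteq> {s. exploration_schedule s = Some i}"
      using infinite_arbitrarily_large[OF infinite_exploration_rounds, of "(Suc k * N k)\<^sup>2" i] by blast
    then obtain T where "B \<subseteq> {..<T}" using finite_nat_bounded by blast
    then have "B \<subseteq> exploration_rounds i t" if "t \<ge> T" for t
      using B(3) that by (auto simp: exploration_rounds_def)
    then have "card B \<le> card (exploration_rounds i t)" if "t \<ge> T" for t
      using that by (intro card_mono finite_exploration_rounds) auto
    then show ?thesis using B(2) by auto
  qed
  then have "\<exists>T. \<forall>i. \<forall>t\<ge>T i. (Suc k * N k)\<^sup>2 \<le> card (exploration_rounds i t)"
    by (intro choice allI)
  then obtain T where T: "\<And>i t. t \<ge> T i \<Longrightarrow> (Suc k * N k)\<^sup>2 \<le> card (exploration_rounds i t)" by blast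
  \<comment> \<open>Inserting 0 keeps the maximum meaningful when \<open>N k\<close> is 0.\<close>
  have "k \<le> level N t" if t: "t \<ge> max k (Max (insert 0 (T ` {..<N k})))" for t
  proof -
    have "t \<ge> T i" if "i < N k" for i
    proof -
      have "T i \<le> Max (insert 0 (T ` {..<N k}))" using that by (intro Max_ge) auto
      also have "\<dots> \<le> t" using t by (rule max.boundedE)
      finally show ?thesis .
    qed
    then have "k \<in> {k. k \<le> t \<and> (k = 0 \<or> (\<forall>i<N k. (Suc k * N k)\<^sup>2 \<le> card (exploration_rounds i t)))}"
      using t T by simp
    then show ?thesis unfolding level_def by (intro Max_ge) auto
  qed
  then show "\<forall>\<^sub>F t in sequentially. k \<le> level N t"
    unfolding eventually_sequentially by blast
qed

text \<open>The exploration rounds have density 0, and the remaining summands tend to 0, hence so do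
  their averages.\<close>

lemma regret_rate_sublinear: "(\<lambda>t. regret_rate N t / real t) \<longlonglongrightarrow> 0"
proof -
  have "(\<lambda>n. 3 / real (Suc n)) \<longlonglongrightarrow> 0"
    using tendsto_mult[OF tendsto_const LIMSEQ_inverse_real_of_nat, of 3] by (simp add: divide_inverse)
  from filterlim_compose[OF this level_tendsto]
  have "(\<lambda>s. 3 / real (Suc (level N s))) \<longlonglongrightarrow> 0" .
  from tendsto_add[OF exploration_rounds_sparse cesaro_null[OF this]] show ?thesis
    by (simp add: regret_rate_def sum.distrib add_divide_distrib sum.If_cases Int_def)
qed

lemma best_estimate_properties:
  assumes "n > 0"
  shows "best_estimate n t h < n" "\<And>j. j < n \<Longrightarrow> estimate j t h \<le> estimate (best_estimate n t h) t h"
proof -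
  have "\<exists>i<n. \<forall>j<n. estimate j t h \<le> estimate i t h"
  proof -
    have "Max ((\<lambda>i. estimate i t h) ` {..<n}) \<in> (\<lambda>i. estimate i t h) ` {..<n}"
      using assms by (intro Max_in) auto
    then obtain i where i: "i < n" "Max ((\<lambda>i. estimate i t h) ` {..<n}) = estimate i t h"
      by auto
    have "estimate j t h \<le> estimate i t h" if "j < n" for j
      unfolding i(2)[symmetric] using that by (intro Max_ge) auto
    with i(1) show ?thesis by blast
  qed
  from LeastI_ex[OF this] show "best_estimate n t h < n"
    "\<And>j. j < n \<Longrightarrow> estimate j t h \<le> estimate (best_estimate n t h) t h"
    unfolding best_estimate_def by auto
qed

lemma measurable_explore_exploit_arm:
  assumes "range a \<subseteq> space M"
  shows "explore_exploit_arm a N t \<in> PiM {0..<t} (\<lambda>_. M \<Otimes>\<^sub>M borel) \<rightarrow>\<^sub>M M"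
proof -
  let ?H = "PiM {0..<t} (\<lambda>_. M \<Otimes>\<^sub>M (borel :: real measure))"
  have est: "estimate i t \<in> borel_measurable ?H" for i
    unfolding estimate_def
    by (intro borel_measurable_divide borel_measurable_sum measurable_round_reward) (auto simp: exploration_rounds_def)
  have [measurable]: "best_estimate n t \<in> ?H \<rightarrow>\<^sub>M count_space UNIV" for n
  proof -
    have "Measurable.pred ?H (\<lambda>h. i < n \<and> (\<forall>j\<in>{..<n}. estimate j t h \<le> estimate i t h))" for i
      by (intro pred_intros_logic pred_intros_finite)
         (auto simp: pred_def intro!: borel_measurable_le[OF est est])
    then show ?thesis
      unfolding best_estimate_def[abs_def] lessThan_iff Ball_def by (rule measurable_Least)
  qed
  have [measurable]: "a \<in> count_space UNIV \<rightarrow>\<^sub>M M" using assms by auto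
  show ?thesis
    unfolding explore_exploit_arm_def[abs_def] by (cases "exploration_schedule t") auto
qed


lemma bandit_algorithm_explore_exploit:
  assumes "range a \<subseteq> space M"
  shows "bandit_algorithm M (\<lambda>t h. return M (explore_exploit_arm a N t h))"
  unfolding bandit_algorithm_def
  by (intro allI measurable_compose[OF measurable_explore_exploit_arm[OF assms] measurable_return_prob_space])

section \<open>Regret of the algorithm on an arbitrary instance\<close>

locale explore_exploit = Metric_space X D for X :: "'a set" and D +
  fixes M :: "'a measure" and a :: "nat \<Rightarrow> 'a" and N :: "nat \<Rightarrow> nat" and \<mu> \<nu>
  assumes arms: "arm_space X D M" and inst: "lipschitz_mab_instance X D M \<mu> \<nu>" and X_ne: "X \<noteq> {}"
    and a_in: "range a \<subseteq> X"
    and net: "\<And>k y. y \<in> X \<Longrightarrow> \<exists>i<N k. D y (a i) < 1 / real (Suc k)"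
begin

lemma space_M [simp]: "space M = X"
  using arms by (simp add: arm_space_def)

lemma payoff_Lipschitz: "x \<in> X \<Longrightarrow> y \<in> X \<Longrightarrow> \<bar>\<mu> x - \<mu> y\<bar> \<le> D x y"
  and payoff_range: "x \<in> X \<Longrightarrow> 0 \<le> \<mu> x" "x \<in> X \<Longrightarrow> \<mu> x \<le> 1"
  and reward_range: "x \<in> X \<Longrightarrow> emeasure (\<nu> x) {0..1} = 1"
  and reward_mean: "x \<in> X \<Longrightarrow> (\<integral>y. y \<partial>\<nu> x) = \<mu> x"
  using inst by (auto simp: lipschitz_mab_instance_def Pi_iff)

sublocale bandit_run M "\<lambda>t h. return M (explore_exploit_arm a N t h)" \<nu>
  using inst a_in by unfold_locales (auto intro!: bandit_algorithm_explore_exploit simp: lipschitz_mab_instance_def)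

lemma payoff_measurable [measurable]: "\<mu> \<in> borel_measurable M"
  using Metric_space_axioms arms payoff_Lipschitz by (rule measurable_payoff)

lemma arm_measurable [measurable]: "explore_exploit_arm a N t \<in> histories t \<rightarrow>\<^sub>M M"
  by (rule measurable_explore_exploit_arm) (use a_in in simp)

lemma arm_in: "explore_exploit_arm a N t h \<in> X"
  using a_in by (auto simp: explore_exploit_arm_def)

lemma payoff_le_Sup: "x \<in> X \<Longrightarrow> \<mu> x \<le> (SUP x\<in>X. \<mu> x)"
  by (rule cSUP_upper) (auto intro!: bdd_aboveI[of _ 1] simp: payoff_range)

lemma Sup_payoff_le: "(SUP x\<in>X. \<mu> x) \<le> 1"
  using X_ne by (intro cSUP_least) (auto simp: payoff_range)

text \<open>This holds for every single history. The best arm is within \<open>1 / (k + 1)\<close>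
  of a net arm, and the chosen arm loses against that one at most the two estimation errors. Errors
  are traded for their squares so that second moments suffice; \<open>\<eta>\<close> is chosen such
  that the price, \<open>\<eta>\<close> for each of the \<open>n\<close> arms, is another
  \<open>1 / (k + 1)\<close>.\<close>

lemma exploitation_gap_le:
  assumes t: "exploration_schedule t = None" and k: "k = level N t" "k \<noteq> 0" and n: "n = N k"
    and \<eta>: "\<eta> = 1 / (real (Suc k) * real n)"
  shows "(SUP x\<in>X. \<mu> x) - \<mu> (explore_exploit_arm a N t h) \<le> 2 / real (Suc k) +
    (\<Sum>i<n. 1 / ((real (card (exploration_rounds i t)))\<^sup>2 * \<eta>) *
       (\<Sum>s\<in>exploration_rounds i t. snd (h s) - \<mu> (a i))\<^sup>2)"
proof -
  define c where "c i = real (card (exploration_rounds i t))" for i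
  define Z where "Z i = (\<Sum>s\<in>exploration_rounds i t. snd (h s) - \<mu> (a i))" for i
  define b where "b = best_estimate n t h"
  obtain x0 where "x0 \<in> X" using X_ne by blast
  then have n0: "n > 0" using net[of x0 k] n by auto
  have \<eta>0: "\<eta> > 0" using \<eta> n0 by simp
  have c0: "c i > 0" if "i < n" for i
  proof -
    have "0 < (Suc k * N k)\<^sup>2" using n0 n by simp
    also have "\<dots> \<le> card (exploration_rounds i t)"
      using level_admissible[of N t] that k n by auto
    finally show ?thesis by (simp add: c_def)
  qed
  have est: "estimate i t h = \<mu> (a i) + Z i / c i" if "i < n" for i
    using c0[OF that] by (auto simp: estimate_def Z_def c_def sum_subtractf diff_divide_distrib)
  have arm: "explore_exploit_arm a N t h = a b"
    using t k n by (simp add: explore_exploit_arm_def b_def)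
  have b: "b < n" "\<And>j. j < n \<Longrightarrow> estimate j t h \<le> estimate b t h"
    unfolding b_def using best_estimate_properties[OF n0] by auto
  define w where "w i = \<bar>Z i\<bar> / c i" for i
  have w0: "w i \<ge> 0" if "i < n" for i using c0[OF that] by (simp add: w_def)
  have w_sum: "w i \<le> (\<Sum>i<n. w i)" if "i < n" for i
    using w0 that by (intro member_le_sum) auto
  \<comment> \<open>The inequality between arithmetic and geometric mean, weighted by
    \<open>\<eta>\<close>.\<close>
  have w_sq: "2 * w i \<le> \<eta> + 1 / ((c i)\<^sup>2 * \<eta>) * (Z i)\<^sup>2" if "i < n" for i
  proof -
    have "0 \<le> (\<eta> - w i)\<^sup>2" by simp
    then have "2 * w i * \<eta> \<le> \<eta>\<^sup>2 + (w i)\<^sup>2" by (simp add: power2_eq_square algebra_simps)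
    then have "2 * w i \<le> (\<eta>\<^sup>2 + (w i)\<^sup>2) / \<eta>" using \<eta>0 by (simp add: pos_le_divide_eq)
    also have "\<dots> = \<eta> + (w i)\<^sup>2 / \<eta>" using \<eta>0 by (simp add: add_divide_distrib power2_eq_square)
    also have "(w i)\<^sup>2 / \<eta> = 1 / ((c i)\<^sup>2 * \<eta>) * (Z i)\<^sup>2"
      by (simp add: w_def power_divide)
    finally show ?thesis by simp
  qed
  \<comment> \<open>The errors of the net arm \<open>j\<close> and of the chosen arm
    \<open>b\<close> are each bounded by the sum of all errors, because which arms these are depends
    on \<open>y\<close> and on the history.\<close>
  have "(SUP x\<in>X. \<mu> x) \<le> \<mu> (a b) + 1 / real (Suc k) + 2 * (\<Sum>i<n. w i)"
  proof (rule cSUP_least[OF X_ne])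
    fix y assume y: "y \<in> X"
    obtain j where j: "j < n" "D y (a j) < 1 / real (Suc k)" using net[OF y] n by blast
    have "\<mu> y \<le> \<mu> (a j) + 1 / real (Suc k)"
      using payoff_Lipschitz[OF y, of "a j"] j(2) a_in by fastforce
    also have "\<mu> (a j) = estimate j t h - Z j / c j" using est[OF j(1)] by simp
    also have "\<dots> \<le> estimate b t h + w j"
      using b(2)[OF j(1)] c0[OF j(1)] abs_ge_minus_self[of "Z j / c j"] by (simp add: w_def abs_divide)
    also have "\<dots> \<le> \<mu> (a b) + w b + w j"
      using est[OF b(1)] c0[OF b(1)] abs_ge_self[of "Z b / c b"] by (simp add: w_def abs_divide)
    also have "\<dots> \<le> \<mu> (a b) + 2 * (\<Sum>i<n. w i)" using w_sum[OF b(1)] w_sum[OF j(1)] by simp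
    finally show "\<mu> y \<le> \<mu> (a b) + 1 / real (Suc k) + 2 * (\<Sum>i<n. w i)" by simp
  qed
  also have "2 * (\<Sum>i<n. w i) \<le> (\<Sum>i<n. \<eta> + 1 / ((c i)\<^sup>2 * \<eta>) * (Z i)\<^sup>2)"
    unfolding sum_distrib_left using w_sq by (intro sum_mono) auto
  also have "\<dots> = 1 / real (Suc k) + (\<Sum>i<n. 1 / ((c i)\<^sup>2 * \<eta>) * (Z i)\<^sup>2)"
    unfolding sum.distrib using \<eta> n0 by simp
  finally show ?thesis
    unfolding arm Z_def c_def by simp
qed

text \<open>Taking expectations in the bound for single histories replaces the squared deviations by
  at most \<open>c i\<close>. Admissibility of the level says
  \<open>c i \<ge> 1 / \<eta>\<^sup>2\<close>, so each arm contributes at most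
  \<open>1 / (c i * \<eta>) \<le> \<eta>\<close>, and all \<open>n\<close> arms the third
  \<open>1 / (k + 1)\<close>.\<close>

lemma expected_exploitation_gap_le:
  assumes t: "exploration_schedule t = None"
  shows "(SUP x\<in>X. \<mu> x) - (\<integral>h. \<mu> (explore_exploit_arm a N t h) \<partial>law t) \<le> 3 / real (Suc (level N t))"
proof -
  interpret P: prob_space "law t" by (rule prob_space_law)
  let ?S = "SUP x\<in>X. \<mu> x" and ?g = "explore_exploit_arm a N t"
  have ig: "integrable (law t) (\<lambda>h. \<mu> (?g h))"
    by (rule P.integrable_const_bound[of _ 1]) (use payoff_range[OF arm_in] in auto)
  have eq: "?S - (\<integral>h. \<mu> (?g h) \<partial>law t) = (\<integral>h. ?S - \<mu> (?g h) \<partial>law t)"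
    using ig by (simp add: P.prob_space)
  show ?thesis
  proof (cases "level N t = 0")
    case True
    have "0 \<le> (\<integral>h. \<mu> (?g h) \<partial>law t)" by (rule integral_nonneg_AE) (simp add: payoff_range arm_in)
    then show ?thesis using True Sup_payoff_le by simp
  next
    case False
    define k where "k = level N t"
    define n where "n = N k"
    define \<eta> where "\<eta> = 1 / (real (Suc k) * real n)"
    define c where "c i = real (card (exploration_rounds i t))" for i
    define Z where "Z i h = (\<Sum>s\<in>exploration_rounds i t. snd (h s) - \<mu> (a i))" for i and h :: "nat \<Rightarrow> 'a \<times> real"
    obtain x0 where "x0 \<in> X" using X_ne by blast
    then have n0: "n > 0" using net[of x0 k] n_def by auto
    have \<eta>0: "\<eta> > 0" using \<eta>_def n0 by simp
    have c_ge: "c i \<ge> 1 / \<eta>\<^sup>2" if "i < n" for i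
    proof -
      have "(Suc k * n)\<^sup>2 \<le> card (exploration_rounds i t)"
        using level_admissible[of N t] that False unfolding k_def n_def by auto
      then have "real ((Suc k * n)\<^sup>2) \<le> c i" unfolding c_def by (rule of_nat_mono)
      then show ?thesis unfolding \<eta>_def by (simp add: power_divide distrib_right)
    qed
    have c0: "c i > 0" if "i < n" for i
      using c_ge[OF that] \<eta>0 by (smt (verit) zero_less_divide_1_iff zero_less_power)
    have Z_meas [measurable]: "Z i \<in> borel_measurable (law t)" for i
      unfolding Z_def
      by (intro borel_measurable_sum borel_measurable_diff) (auto simp: exploration_rounds_def intro!: measurable_round_reward cong: measurable_cong_sets)
    have moment: "(\<integral>\<^sup>+h. ennreal ((Z i h)\<^sup>2) \<partial>law t) \<le> ennreal (c i)" for i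
      unfolding Z_def c_def exploration_rounds_def
      by (rule second_moment_fixed_arm_le)
         (use a_in reward_range reward_mean in \<open>auto simp: explore_exploit_arm_def\<close>)
    \<comment> \<open>The gap is nonnegative, so it can be bounded by nonnegative integrals, where
      the squares need only be measurable.\<close>
    have "ennreal (\<integral>h. ?S - \<mu> (?g h) \<partial>law t) = (\<integral>\<^sup>+h. ennreal (?S - \<mu> (?g h)) \<partial>law t)"
      using ig by (intro nn_integral_eq_integral[symmetric]) (auto simp: payoff_le_Sup arm_in)
    also have "\<dots> \<le> (\<integral>\<^sup>+h. ennreal (2 / real (Suc k)) + (\<Sum>i<n. ennreal (1 / ((c i)\<^sup>2 * \<eta>)) * ennreal ((Z i h)\<^sup>2)) \<partial>law t)"
    proof (rule nn_integral_mono)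
      fix h
      have "?S - \<mu> (?g h) \<le> 2 / real (Suc k) + (\<Sum>i<n. 1 / ((c i)\<^sup>2 * \<eta>) * (Z i h)\<^sup>2)"
        using exploitation_gap_le[OF t k_def _ n_def \<eta>_def] False unfolding Z_def c_def k_def by blast
      then have "ennreal (?S - \<mu> (?g h)) \<le> ennreal (2 / real (Suc k) + (\<Sum>i<n. 1 / ((c i)\<^sup>2 * \<eta>) * (Z i h)\<^sup>2))"
        by (rule ennreal_leI)
      also have "\<dots> = ennreal (2 / real (Suc k)) + (\<Sum>i<n. ennreal (1 / ((c i)\<^sup>2 * \<eta>) * (Z i h)\<^sup>2))"
        using \<eta>0 by (subst ennreal_plus) (auto intro!: sum_nonneg sum_ennreal[symmetric] mult_nonneg_nonneg)
      also have "\<dots> = ennreal (2 / real (Suc k)) + (\<Sum>i<n. ennreal (1 / ((c i)\<^sup>2 * \<eta>)) * ennreal ((Z i h)\<^sup>2))"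
        using \<eta>0 by (subst ennreal_mult) auto
      finally show "ennreal (?S - \<mu> (?g h)) \<le> \<dots>" .
    qed
    also have "\<dots> = ennreal (2 / real (Suc k)) + (\<Sum>i<n. ennreal (1 / ((c i)\<^sup>2 * \<eta>)) * (\<integral>\<^sup>+h. ennreal ((Z i h)\<^sup>2) \<partial>law t))"
      by (simp add: nn_integral_add nn_integral_sum nn_integral_cmult P.emeasure_space_1)
    also have "\<dots> \<le> ennreal (2 / real (Suc k)) + (\<Sum>i<n. ennreal \<eta>)"
    proof (intro add_left_mono sum_mono)
      fix i assume "i \<in> {..<n}"
      then have i: "i < n" by simp
      have "ennreal (1 / ((c i)\<^sup>2 * \<eta>)) * (\<integral>\<^sup>+h. ennreal ((Z i h)\<^sup>2) \<partial>law t) \<le> ennreal (1 / ((c i)\<^sup>2 * \<eta>)) * ennreal (c i)"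
        by (intro mult_left_mono moment) simp
      also have "\<dots> = ennreal (1 / ((c i)\<^sup>2 * \<eta>) * c i)"
        using c0[OF i] \<eta>0 by (intro ennreal_mult[symmetric]) auto
      also have "1 / ((c i)\<^sup>2 * \<eta>) * c i = 1 / (c i * \<eta>)"
        using c0[OF i] by (simp add: power2_eq_square)
      also have "1 / (c i * \<eta>) \<le> \<eta>"
        using c_ge[OF i] c0[OF i] \<eta>0 by (simp add: field_simps power2_eq_square)
      finally show "ennreal (1 / ((c i)\<^sup>2 * \<eta>)) * (\<integral>\<^sup>+h. ennreal ((Z i h)\<^sup>2) \<partial>law t) \<le> ennreal \<eta>"
        by (simp add: ennreal_leI)
    qed
    also have "(\<Sum>i<n. ennreal \<eta>) = ennreal (real n * \<eta>)"
      using \<eta>0 by (simp add: ennreal_mult ennreal_of_nat_eq_real_of_nat)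
    also have "real n * \<eta> = 1 / real (Suc k)" using n0 by (simp add: \<eta>_def)
    also have "ennreal (2 / real (Suc k)) + ennreal (1 / real (Suc k)) = ennreal (3 / real (Suc k))"
      by (simp add: ennreal_plus[symmetric] add_divide_distrib[symmetric] del: ennreal_plus)
    finally show ?thesis
      unfolding eq k_def[symmetric] by (simp add: ennreal_le_iff)
  qed
qed

lemma regret_le_rate: "regret M (\<lambda>t h. return M (explore_exploit_arm a N t h)) \<mu> \<nu> t \<le> regret_rate N t"
proof (induction t)
  case 0
  interpret P: prob_space "law 0" by (rule prob_space_law)
  show ?case by (simp add: regret_def regret_rate_def)
next
  case (Suc t)
  let ?S = "SUP x\<in>X. \<mu> x" and ?g = "explore_exploit_arm a N t"
  have "(\<integral>h. (\<Sum>s<Suc t. \<mu> (fst (h s))) \<partial>law (Suc t)) =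
      (\<integral>h. (\<Sum>s<t. \<mu> (fst (h s))) \<partial>law t) + (\<integral>h. \<mu> (?g h) \<partial>law t)"
    by (rule expected_reward_Suc) (auto simp: payoff_range)
  moreover have "?S - (\<integral>h. \<mu> (?g h) \<partial>law t) \<le>
      (if exploration_schedule t \<noteq> None then 1 else 0) + 3 / real (Suc (level N t))"
  proof (cases "exploration_schedule t")
    case None
    then show ?thesis using expected_exploitation_gap_le by simp
  next
    case (Some i)
    have "0 \<le> (\<integral>h. \<mu> (?g h) \<partial>law t)" by (rule integral_nonneg_AE) (simp add: payoff_range arm_in)
    then have "?S - (\<integral>h. \<mu> (?g h) \<partial>law t) \<le> 1" using Sup_payoff_le by simp
    then show ?thesis by (rule order_trans) (simp add: Some)
  qed
  moreover have "regret_rate N (Suc t) = regret_rate N t +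
      ((if exploration_schedule t \<noteq> None then 1 else 0) + 3 / real (Suc (level N t)))"
    by (simp add: regret_rate_def)
  moreover have "real (Suc t) * ?S = real t * ?S + ?S" by (simp add: algebra_simps)
  ultimately show ?case
    using Suc unfolding regret_def space_M by linarith
qed

end

text \<open>Algorithm and rate are built from the net sequence alone, so they serve all instances at
  once, even with the constant 1.\<close>

lemma tractable_if_mtotally_bounded:
  assumes "Metric_space X D" "X \<noteq> {}" "arm_space X D M" "Metric_space.mtotally_bounded X D X"
  shows "\<exists>f :: nat \<Rightarrow> real. (\<lambda>t. f t / real t) \<longlonglongrightarrow> 0 \<and> tractable X D M f"
proof -
  interpret Metric_space X D by fact
  obtain a :: "nat \<Rightarrow> 'a" and N where aN: "range a \<subseteq> X"
    "\<And>k y. y \<in> X \<Longrightarrow> \<exists>i<N k. D y (a i) < 1 / real (Suc k)"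
    using dense_sequence_if_mtotally_bounded[OF assms(4,2)] by blast
  let ?A = "\<lambda>t h. return M (explore_exploit_arm a N t h)"
  have "bandit_algorithm M ?A"
    using aN(1) assms(3) by (intro bandit_algorithm_explore_exploit) (simp add: arm_space_def)
  moreover have "\<exists>C. \<forall>t\<ge>1. regret M ?A \<mu> \<nu> t \<le> C * regret_rate N t"
    if "lipschitz_mab_instance X D M \<mu> \<nu>" for \<mu> \<nu>
  proof -
    interpret explore_exploit X D M a N \<mu> \<nu>
      by unfold_locales (use assms that aN in auto)
    show ?thesis using regret_le_rate by (intro exI[of _ 1]) simp
  qed
  ultimately have "tractable X D M (regret_rate N)"
    unfolding tractable_def by blast
  with regret_rate_sublinear show ?thesis by blast
qed

section \<open>Hidden needles\<close>

definition avoiding :: "'a measure \<Rightarrow> 'a set \<Rightarrow> nat \<Rightarrow> (nat \<Rightarrow> 'a \<times> real) set" where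
  "avoiding M V t = {h \<in> space (PiM {0..<t} (\<lambda>_. M \<Otimes>\<^sub>M borel)). \<forall>s<t. fst (h s) \<notin> V}"

context bandit_run
begin

lemma sets_visiting:
  assumes V: "V \<in> sets M" and s: "s < t"
  shows "{h \<in> space (histories t). fst (h s) \<in> V} \<in> sets (histories t)"
  using measurable_sets[OF measurable_round_arm[OF s] V] by (simp add: vimage_def Int_def conj_commute)

lemma sets_avoiding:
  assumes V: "V \<in> sets M"
  shows "avoiding M V t \<in> sets (histories t)"
proof -
  have "avoiding M V t = space (histories t) - (\<Union>s\<in>{..<t}. {h \<in> space (histories t). fst (h s) \<in> V})"
    by (auto simp: avoiding_def)
  also have "\<dots> \<in> sets (histories t)"
    using sets_visiting[OF V] by (intro sets.Diff sets.top sets.finite_UN) auto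
  finally show ?thesis .
qed

lemma indicator_avoiding_Suc:
  assumes "h \<in> space (histories t)" "x \<in> space M"
  shows "indicator (avoiding M V (Suc t)) (h(t := (x, y))) =
    (indicator (avoiding M V t) h * indicator (- V) x :: ennreal)"
proof -
  have "h(t := (x, y)) \<in> space (histories (Suc t))"
    using measurable_space[OF measurable_extend[OF measurable_const measurable_ident], of h t "(x, y)"] assms
    by (simp add: space_pair_measure)
  then show ?thesis
    using assms by (auto simp: avoiding_def indicator_def less_Suc_eq)
qed

text \<open>The event splits into a condition on the past and one on the last arm, so that only
  reward distributions of arms outside \<open>V\<close> matter. The second claim makes the inner
  integral a legitimate weight for the preceding round.\<close>

lemma nn_integral_avoiding_Suc:
  assumes F [measurable]: "F \<in> borel_measurable (histories (Suc t))" and V [measurable]: "V \<in> sets M"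
  shows "(\<integral>\<^sup>+h. F h * indicator (avoiding M V (Suc t)) h \<partial>law (Suc t)) =
    (\<integral>\<^sup>+h. (\<integral>\<^sup>+x. (\<integral>\<^sup>+y. F (h(t := (x, y))) \<partial>\<nu> x) * indicator (- V) x \<partial>A t h) * indicator (avoiding M V t) h \<partial>law t)"
    and "(\<lambda>h. \<integral>\<^sup>+x. (\<integral>\<^sup>+y. F (h(t := (x, y))) \<partial>\<nu> x) * indicator (- V) x \<partial>A t h) \<in> borel_measurable (histories t)"
proof -
  have [measurable]: "avoiding M V (Suc t) \<in> sets (histories (Suc t))" by (rule sets_avoiding[OF V])
  \<comment> \<open>\<open>- V\<close> is the complement in the whole type and need not be in
    \<open>sets M\<close>; its indicator is nevertheless measurable on \<open>M\<close>.\<close>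
  have cV: "(\<lambda>x. indicator (- V) x :: ennreal) \<in> borel_measurable M"
  proof -
    have "(\<lambda>x. 1 - indicator V x :: ennreal) \<in> borel_measurable M" by measurable
    moreover have "(\<lambda>x. 1 - indicator V x :: ennreal) = indicator (- V)" by (auto simp: indicator_def)
    ultimately show ?thesis by simp
  qed
  have F2: "(\<lambda>p. F ((fst (fst p))(t := (snd (fst p), snd p)))) \<in> borel_measurable ((histories t \<Otimes>\<^sub>M M) \<Otimes>\<^sub>M borel)"
    by (rule measurable_compose[OF measurable_extend F]) measurable
  have "(\<lambda>p. \<integral>\<^sup>+y. F ((fst p)(t := (snd p, y))) \<partial>\<nu> (snd p)) \<in> borel_measurable (histories t \<Otimes>\<^sub>M M)"
    by (rule nn_integral_measurable_subprob_algebra2[where N = borel])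
       (use F2 measurable_compose[OF measurable_snd measurable_prob_algebraD[OF reward_kernel]] in
         \<open>auto simp: case_prod_unfold\<close>)
  moreover have "(\<lambda>p. indicator (- V) (snd p) :: ennreal) \<in> borel_measurable (histories t \<Otimes>\<^sub>M M)"
    by (rule measurable_compose[OF measurable_snd cV])
  ultimately have K: "(\<lambda>p. (\<integral>\<^sup>+y. F ((fst p)(t := (snd p, y))) \<partial>\<nu> (snd p)) * indicator (- V) (snd p))
      \<in> borel_measurable (histories t \<Otimes>\<^sub>M M)"
    by (rule borel_measurable_times_ennreal)
  show "(\<lambda>h. \<integral>\<^sup>+x. (\<integral>\<^sup>+y. F (h(t := (x, y))) \<partial>\<nu> x) * indicator (- V) x \<partial>A t h) \<in> borel_measurable (histories t)"
    by (rule nn_integral_measurable_subprob_algebra2[where N = M])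
       (use K measurable_prob_algebraD[OF algorithm_measurable] in \<open>auto simp: case_prod_unfold\<close>)
  have "(\<integral>\<^sup>+h. F h * indicator (avoiding M V (Suc t)) h \<partial>law (Suc t)) =
      (\<integral>\<^sup>+h. (\<integral>\<^sup>+x. (\<integral>\<^sup>+y. F (h(t := (x, y))) * indicator (avoiding M V (Suc t)) (h(t := (x, y))) \<partial>\<nu> x) \<partial>A t h) \<partial>law t)"
    by (rule nn_integral_law_Suc) measurable
  also have "\<dots> = (\<integral>\<^sup>+h. (\<integral>\<^sup>+x. (\<integral>\<^sup>+y. F (h(t := (x, y))) \<partial>\<nu> x) * indicator (- V) x \<partial>A t h) * indicator (avoiding M V t) h \<partial>law t)"
  proof (rule nn_integral_cong)
    fix h assume "h \<in> space (law t)"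
    then have h: "h \<in> space (histories t)" by (simp add: space_law)
    have Kh: "(\<lambda>x. (\<integral>\<^sup>+y. F (h(t := (x, y))) \<partial>\<nu> x) * indicator (- V) x) \<in> borel_measurable (A t h)"
      using measurable_compose[OF measurable_Pair1'[OF h] K] A_in(1)[OF h] by (simp cong: measurable_cong_sets)
    have "(\<integral>\<^sup>+y. F (h(t := (x, y))) * indicator (avoiding M V (Suc t)) (h(t := (x, y))) \<partial>\<nu> x) =
        (\<integral>\<^sup>+y. F (h(t := (x, y))) \<partial>\<nu> x) * indicator (- V) x * indicator (avoiding M V t) h"
      if "x \<in> space (A t h)" for x
    proof -
      have x: "x \<in> space M" using that sets_eq_imp_space_eq[OF A_in(1)[OF h]] by simp
      have "(\<lambda>y. F (h(t := (x, y)))) \<in> borel_measurable (\<nu> x)"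
        using measurable_compose[OF measurable_Pair1'[of "(h, x)" "histories t \<Otimes>\<^sub>M M" borel] F2] \<nu>_in(1)[OF x] h x
        by (simp add: space_pair_measure cong: measurable_cong_sets)
      then show ?thesis
        unfolding indicator_avoiding_Suc[OF h x] by (simp add: nn_integral_multc) (simp add: mult_ac)
    qed
    then have "(\<integral>\<^sup>+x. (\<integral>\<^sup>+y. F (h(t := (x, y))) * indicator (avoiding M V (Suc t)) (h(t := (x, y))) \<partial>\<nu> x) \<partial>A t h) =
      (\<integral>\<^sup>+x. (\<integral>\<^sup>+y. F (h(t := (x, y))) \<partial>\<nu> x) * indicator (- V) x * indicator (avoiding M V t) h \<partial>A t h)"
      by (rule nn_integral_cong)
    also have "\<dots> = (\<integral>\<^sup>+x. (\<integral>\<^sup>+y. F (h(t := (x, y))) \<partial>\<nu> x) * indicator (- V) x \<partial>A t h) * indicator (avoiding M V t) h"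
      by (rule nn_integral_multc[OF Kh])
    finally show "(\<integral>\<^sup>+x. (\<integral>\<^sup>+y. F (h(t := (x, y))) * indicator (avoiding M V (Suc t)) (h(t := (x, y))) \<partial>\<nu> x) \<partial>A t h) = \<dots>" .
  qed
  finally show "(\<integral>\<^sup>+h. F h * indicator (avoiding M V (Suc t)) h \<partial>law (Suc t)) = \<dots>" .
qed

text \<open>In a fixed round the events of playing in \<open>B i\<close> are disjoint, so their
  probabilities are summable and tend to 0. A union bound handles the \<open>t\<close>
  rounds.\<close>

lemma visiting_disjoint_tendsto_0:
  fixes B :: "nat \<Rightarrow> 'a set"
  assumes B: "\<And>i. B i \<in> sets M" and disj: "disjoint_family B"
  shows "(\<lambda>i. measure (law t) (space (histories t) - avoiding M (B i) t)) \<longlonglongrightarrow> 0"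
proof -
  interpret P: prob_space "law t" by (rule prob_space_law)
  let ?E = "\<lambda>s i. {h \<in> space (histories t). fst (h s) \<in> B i}"
  have E: "?E s i \<in> P.events" if "s < t" for s i using sets_visiting[OF B that] by simp
  have "(\<lambda>i. P.prob (?E s i)) \<longlonglongrightarrow> 0" if "s < t" for s
  proof -
    have "disjoint_family (?E s)" using disj by (auto simp: disjoint_family_on_def)
    then have "(\<lambda>i. P.prob (?E s i)) sums P.prob (\<Union>i. ?E s i)"
      using E[OF that] by (intro P.finite_measure_UNION) auto
    then show ?thesis by (intro summable_LIMSEQ_zero) (rule sums_summable)
  qed
  then have lim: "(\<lambda>i. \<Sum>s<t. P.prob (?E s i)) \<longlonglongrightarrow> (\<Sum>s<t. 0)"
    by (intro tendsto_sum) auto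
  have "norm (P.prob (space (histories t) - avoiding M (B i) t)) \<le> (\<Sum>s<t. P.prob (?E s i))" for i
  proof -
    have "space (histories t) - avoiding M (B i) t = (\<Union>s\<in>{..<t}. ?E s i)" by (auto simp: avoiding_def)
    then show ?thesis
      using E P.finite_measure_subadditive_finite[of "{..<t}" "\<lambda>s. ?E s i"] by auto
  qed
  then show ?thesis
    by (rule Lim_null_comparison[OF always_eventually[OF allI]]) (use lim in simp)
qed

text \<open>A history avoiding \<open>V\<close> loses at least \<open>g\<close> in each of its
  \<open>t\<close> rounds, and no history gains more than \<open>S\<close> per round.\<close>

lemma regret_ge_avoiding:
  fixes \<mu> :: "'a \<Rightarrow> real"
  assumes \<mu>: "\<mu> \<in> borel_measurable M" and V: "V \<in> sets M"
    and bd: "\<And>x. x \<in> space M \<Longrightarrow> 0 \<le> \<mu> x" "\<And>x. x \<in> space M \<Longrightarrow> \<mu> x \<le> S"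
    and S: "S = (SUP x\<in>space M. \<mu> x)"
    and gap: "\<And>x. x \<in> space M \<Longrightarrow> x \<notin> V \<Longrightarrow> \<mu> x \<le> S - g"
  shows "real t * g * measure (law t) (avoiding M V t) \<le> regret M A \<mu> \<nu> t"
proof -
  interpret P: prob_space "law t" by (rule prob_space_law)
  have av: "avoiding M V t \<in> P.events" using sets_avoiding[OF V] by simp
  let ?G = "\<lambda>h. \<Sum>s<t. \<mu> (fst ((h :: nat \<Rightarrow> 'a \<times> real) s))"
  have arm: "fst (h s) \<in> space M" if "h \<in> space (law t)" "s < t" for h s
    using measurable_space[OF measurable_round_arm[OF that(2)]] that(1) by (simp add: space_law)
  have meas: "?G \<in> borel_measurable (law t)"
    using measurable_compose[OF measurable_round_arm \<mu>] by (intro borel_measurable_sum) (auto cong: measurable_cong_sets)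
  have G: "0 \<le> ?G h" "?G h \<le> real t * S" if "h \<in> space (law t)" for h
    using arm[OF that] bd sum_bounded_above[of "{..<t}" "\<lambda>s. \<mu> (fst (h s))" S] by (auto intro!: sum_nonneg)
  have iG: "integrable (law t) ?G"
    by (rule P.integrable_const_bound[of _ "real t * S"]) (use G meas in auto)
  have "(\<integral>h. ?G h \<partial>law t) \<le> (\<integral>h. real t * S - real t * g * indicator (avoiding M V t) h \<partial>law t)"
  proof (rule integral_mono[OF iG])
    show "integrable (law t) (\<lambda>h. real t * S - real t * g * indicator (avoiding M V t) h)"
      using av by (intro Bochner_Integration.integrable_diff integrable_mult_right) (auto simp: P.emeasure_eq_measure)
    fix h assume h: "h \<in> space (law t)"
    show "?G h \<le> real t * S - real t * g * indicator (avoiding M V t) h"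
    proof (cases "h \<in> avoiding M V t")
      case True
      then have "?G h \<le> real t * (S - g)"
        using sum_bounded_above[of "{..<t}" "\<lambda>s. \<mu> (fst (h s))" "S - g"] gap arm[OF h] by (auto simp: avoiding_def)
      then show ?thesis using True by (simp add: algebra_simps)
    qed (use G[OF h] in simp)
  qed
  also have "\<dots> = real t * S - real t * g * P.prob (avoiding M V t)"
    using av sets.sets_into_space[OF av] by (simp add: P.emeasure_eq_measure P.prob_space Int_absorb2)
  finally show ?thesis
    unfolding regret_def S[symmetric] by simp
qed

end

text \<open>As long as the algorithm stays outside \<open>V\<close> it receives the same rewards in
  both environments and cannot tell them apart. This transfers probabilities from an instance with
  finitely many needles to the one with all of them.\<close>

lemma measure_avoiding_cong:
  assumes "bandit_run M A \<nu>" "bandit_run M A \<nu>'" and V: "V \<in> sets M"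
    and eq: "\<And>x. x \<in> space M \<Longrightarrow> x \<notin> V \<Longrightarrow> \<nu> x = \<nu>' x"
  shows "measure (history_law M A \<nu> t) (avoiding M V t) = measure (history_law M A \<nu>' t) (avoiding M V t)"
proof -
  interpret B: bandit_run M A \<nu> by fact
  interpret B': bandit_run M A \<nu>' by fact
  \<comment> \<open>The weight \<open>F\<close> makes the induction work: undoing one round replaces it by a conditional expectation.\<close>
  have *: "(\<integral>\<^sup>+h. F h * indicator (avoiding M V t) h \<partial>B.law t) = (\<integral>\<^sup>+h. F h * indicator (avoiding M V t) h \<partial>B'.law t)"
    if "F \<in> borel_measurable (B.histories t)" for F
    using that
  proof (induction t arbitrary: F)
    case 0
    then show ?case by (simp add: B.law_0 B'.law_0)
  next
    case (Suc t)
    let ?K = "\<lambda>\<nu> h. \<integral>\<^sup>+x. (\<integral>\<^sup>+y. F (h(t := (x, y))) \<partial>\<nu> x) * indicator (- V) x \<partial>A t h"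
    \<comment> \<open>Inside \<open>V\<close> the indicator kills the integrand, outside the kernels
      agree.\<close>
    have K: "?K \<nu> h = ?K \<nu>' h" if "h \<in> space (B.histories t)" for h
      using eq sets_eq_imp_space_eq[OF B.A_in(1)[OF that]]
      by (intro nn_integral_cong) (auto simp: indicator_def)
    have "(\<integral>\<^sup>+h. ?K \<nu> h * indicator (avoiding M V t) h \<partial>B.law t) =
        (\<integral>\<^sup>+h. ?K \<nu> h * indicator (avoiding M V t) h \<partial>B'.law t)"
      by (rule Suc.IH[OF B.nn_integral_avoiding_Suc(2)[OF Suc.prems V]])
    also have "\<dots> = (\<integral>\<^sup>+h. ?K \<nu>' h * indicator (avoiding M V t) h \<partial>B'.law t)"
      using K by (intro nn_integral_cong) (simp add: B'.space_law)
    finally show ?case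
      unfolding B.nn_integral_avoiding_Suc(1)[OF Suc.prems V] B'.nn_integral_avoiding_Suc(1)[OF Suc.prems V] .
  qed
  from *[of "\<lambda>_. 1"] have "emeasure (B.law t) (avoiding M V t) = emeasure (B'.law t) (avoiding M V t)"
    using B.sets_avoiding[OF V] by simp
  then show ?thesis by (simp add: measure_def)
qed


section \<open>Payoff functions made of needles\<close>

text \<open>The upper envelope of cones of slope 1 with tips of height \<open>c l\<close> at
  \<open>a l\<close>, for \<open>l\<close> in \<open>L\<close>, and of the zero function. Absent
  needles contribute 0, so the supremum ranges over all naturals and is never over an empty
  set.\<close>

definition needles :: "('a \<Rightarrow> 'a \<Rightarrow> real) \<Rightarrow> (nat \<Rightarrow> 'a) \<Rightarrow> (nat \<Rightarrow> real) \<Rightarrow> nat set \<Rightarrow> 'a \<Rightarrow> real" where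
  "needles D a c L x = (SUP l. if l \<in> L then max 0 (c l - D x (a l)) else 0)"

locale needle_family = Metric_space X D for X :: "'a set" and D +
  fixes a :: "nat \<Rightarrow> 'a" and c :: "nat \<Rightarrow> real" and r :: real
  assumes centers: "range a \<subseteq> X" and heights: "\<And>l. 0 \<le> c l" "\<And>l. c l \<le> r" and r1: "r \<le> 1"
begin

lemma needle_le: "(if l \<in> L then max 0 (c l - D x (a l)) else 0) \<le> r"
proof -
  have "c l - D x (a l) \<le> r" using heights(2)[of l] nonneg[of x "a l"] by linarith
  then show ?thesis using heights[of l] by auto
qed

lemma needles_upper: "(if l \<in> L then max 0 (c l - D x (a l)) else 0) \<le> needles D a c L x"
  unfolding needles_def using needle_le by (intro cSUP_upper bdd_aboveI2[of _ _ r]) auto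

lemma needles_least:
  assumes "0 \<le> z" "\<And>l. l \<in> L \<Longrightarrow> c l - D x (a l) \<le> z"
  shows "needles D a c L x \<le> z"
  unfolding needles_def using assms by (intro cSUP_least) auto

lemma needles_range: "0 \<le> needles D a c L x" "needles D a c L x \<le> r"
proof -
  show "0 \<le> needles D a c L x"
    using needles_upper[of 0 L x] by (rule order_trans[rotated]) auto
  show "needles D a c L x \<le> r"
    unfolding needles_def using needle_le by (intro cSUP_least) auto
qed

lemma needles_Lipschitz:
  assumes "x \<in> X" "y \<in> X"
  shows "\<bar>needles D a c L x - needles D a c L y\<bar> \<le> D x y"
proof -
  have *: "needles D a c L x \<le> needles D a c L y + D x y" if "x \<in> X" "y \<in> X" for x y
  proof (rule needles_least)
    show "0 \<le> needles D a c L y + D x y" using needles_range(1) by simp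
    fix l assume "l \<in> L"
    then have "c l - D y (a l) \<le> needles D a c L y" using needles_upper[of l L y] by simp
    moreover have "D y (a l) \<le> D x y + D x (a l)"
      using triangle[of y x "a l"] centers that commute[of x y] by auto
    ultimately show "c l - D x (a l) \<le> needles D a c L y + D x y" by simp
  qed
  show ?thesis using *[OF assms] *[OF assms(2,1)] commute[of x y] by simp
qed

lemma needles_instance:
  assumes arms: "arm_space X D M"
  shows "lipschitz_mab_instance X D M (needles D a c L) (\<lambda>x. return borel (needles D a c L x))"
proof -
  have "needles D a c L \<in> borel_measurable M"
    by (rule measurable_payoff[OF Metric_space_axioms arms needles_Lipschitz])
  then have "(\<lambda>x. return borel (needles D a c L x)) \<in> M \<rightarrow>\<^sub>M prob_algebra borel"
    by (rule measurable_compose[OF _ measurable_return_prob_space])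
  moreover have "needles D a c L x \<in> {0..1}" for x using needles_range[of L x] r1 by simp
  ultimately show ?thesis
    unfolding lipschitz_mab_instance_def using needles_Lipschitz
    by (auto simp: integral_return)
qed

text \<open>A cone of height at most \<open>r\<close> and slope 1 vanishes at distance
  \<open>r\<close> from its center, so the additional needles cannot be seen there.\<close>

lemma needles_off_balls:
  assumes "x \<in> X" and off: "\<And>l. l \<in> L' - L \<Longrightarrow> r \<le> D (a l) x" and "L \<subseteq> L'"
  shows "needles D a c L' x = needles D a c L x"
  unfolding needles_def
proof (rule arg_cong[where f = Sup], rule image_cong[OF refl])
  fix l
  show "(if l \<in> L' then max 0 (c l - D x (a l)) else 0) = (if l \<in> L then max 0 (c l - D x (a l)) else 0)"
    using off[of l] heights(2)[of l] commute[of x "a l"] \<open>L \<subseteq> L'\<close> by auto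
qed

end

section \<open>Lower bound by successively placed needles\<close>

lemma not_tractable_if_separated:
  fixes a :: "nat \<Rightarrow> 'a"
  assumes "Metric_space X D" and arms: "arm_space X D M"
    and diam: "\<And>x y. x \<in> X \<Longrightarrow> y \<in> X \<Longrightarrow> D x y \<le> 1"
    and e: "e > 0" and a: "range a \<subseteq> X" and sep: "\<And>i j. i \<noteq> j \<Longrightarrow> e \<le> D (a i) (a j)"
    and f: "(\<lambda>t. f t / real t) \<longlonglongrightarrow> 0"
  shows "\<not> tractable X D M f"
proof
  assume "tractable X D M f"
  then obtain A where A: "bandit_algorithm M A"
    and bound: "\<And>\<mu> \<nu>. lipschitz_mab_instance X D M \<mu> \<nu> \<Longrightarrow> \<exists>C. \<forall>t\<ge>1. regret M A \<mu> \<nu> t \<le> C * f t"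
    unfolding tractable_def by blast
  interpret Metric_space X D by fact
  have sp: "space M = X" using arms by (simp add: arm_space_def)
  \<comment> \<open>Half the separation makes the balls around the centers disjoint.\<close>
  define r where "r = e / 2"
  have r0: "r > 0" using e by (simp add: r_def)
  \<comment> \<open>Here the bound on the diameter enters; it keeps the needle payoffs in the unit
    interval.\<close>
  have r1: "r \<le> 1"
    using sep[of 0 1] diam[of "a 0" "a 1"] a e by (fastforce simp: r_def)
  define B where "B i = mball (a i) r" for i
  have B: "B i \<in> sets M" for i
    using arms openin_mball by (auto simp: arm_space_def B_def)
  have disj: "disjoint_family B"
    unfolding disjoint_family_on_def
  proof (intro ballI impI)
    fix i j :: nat assume "i \<noteq> j"
    have False if "y \<in> B i" "y \<in> B j" for y
      using that sep[OF \<open>i \<noteq> j\<close>] triangle[of "a i" y "a j"] commute[of y "a j"] by (auto simp: B_def r_def)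
    then show "B i \<inter> B j = {}" by blast
  qed
  \<comment> \<open>\<open>g j\<close> is the regret per round of a player who knows only the
    needles below \<open>j\<close>: the best of them falls short of the supremum \<open>r\<close> by
    this amount.\<close>
  define g where "g j = r * (1/2) ^ j" for j :: nat
  define c where "c l = r - g (Suc l)" for l
  have g0: "g j > 0" for j using r0 by (simp add: g_def)
  have g_mono: "g j \<le> g i" if "i \<le> j" for i j
    using that r0 by (auto simp: g_def intro!: mult_left_mono power_decreasing)
  have g_le: "g j \<le> r" for j using g_mono[of 0 j] by (simp add: g_def)
  have fam: "needle_family X D (\<lambda>l. a (i l)) c r" for i
    by unfold_locales (use a g_le g0 r1 in \<open>auto simp: c_def less_imp_le\<close>)
  define \<mu> where "\<mu> i L = needles D (\<lambda>l. a (i l)) c L" for i L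
  define \<nu> where "\<nu> i L x = return borel (\<mu> i L x)" for i L x
  have inst: "lipschitz_mab_instance X D M (\<mu> i L) (\<nu> i L)" for i L
    unfolding \<mu>_def \<nu>_def by (rule needle_family.needles_instance[OF fam arms])
  have run: "bandit_run M A (\<nu> i L)" for i L
    by unfold_locales (use A inst in \<open>auto simp: lipschitz_mab_instance_def\<close>)

  \<comment> \<open>The times depend on \<open>f\<close> alone and are fixed before any needle is
    placed. The extra factor \<open>1 / (j + 1)\<close> will beat every constant.\<close>
  have "\<exists>t\<ge>1. \<bar>f t\<bar> \<le> real t * (g j / real (Suc j))" for j
  proof -
    have "g j / real (Suc j) > 0" using g0 by simp
    from LIMSEQ_D[OF f this] obtain n where n: "\<And>t. t \<ge> n \<Longrightarrow> \<bar>f t / real t\<bar> < g j / real (Suc j)" by auto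
    then have "\<bar>f (Suc n)\<bar> / real (Suc n) < g j / real (Suc j)" by (metis abs_divide abs_of_nat le_SucI order_refl)
    then have "\<bar>f (Suc n)\<bar> < g j / real (Suc j) * real (Suc n)" by (subst (asm) pos_divide_less_eq) auto
    then show ?thesis by (intro exI[of _ "Suc n"]) (simp add: mult.commute)
  qed
  then obtain T where T: "\<And>j. T j \<ge> 1" "\<And>j. \<bar>f (T j)\<bar> \<le> real (T j) * (g j / real (Suc j))" by metis

  \<comment> \<open>The probability that, facing only the needles below \<open>j\<close>, the
    algorithm enters ball \<open>k\<close> before time \<open>T j\<close>. It depends on
    \<open>i\<close> only through its values below \<open>j\<close>.\<close>
  define p where "p i j k = measure (history_law M A (\<nu> i {..<j}) (T j))
    (space (PiM {0..<T j} (\<lambda>_. M \<Otimes>\<^sub>M borel)) - avoiding M (B k) (T j))" for i j k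
  \<comment> \<open>The ball for needle \<open>l\<close> is chosen once those below \<open>l\<close>
    are known. Only the finitely many \<open>j \<le> l\<close> impose a condition, and all but
    finitely many balls satisfy each. For fixed \<open>j\<close> the bounds sum to 1/2 over
    \<open>l \<ge> j\<close>.\<close>
  have "\<exists>i. \<forall>l. \<forall>j\<le>l. p i j (i l) \<le> (1/2) ^ (l - j + 2)"
  proof (rule dependent_wf_choice[OF wf_less_than, where P = "\<lambda>i l k. \<forall>j\<le>l. p i j k \<le> (1/2) ^ (l - j + 2)"])
    fix i i' :: "nat \<Rightarrow> nat" and l k assume eq: "\<And>z. (z, l) \<in> less_than \<Longrightarrow> i z = i' z"
    have "p i j k = p i' j k" if "j \<le> l" for j
    proof -
      have "\<mu> i {..<j} x = \<mu> i' {..<j} x" for x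
        unfolding \<mu>_def needles_def using eq that
        by (intro arg_cong[where f = Sup] image_cong refl) auto
      then have "\<mu> i {..<j} = \<mu> i' {..<j}" by (rule ext)
      then show ?thesis by (simp add: p_def \<nu>_def[abs_def])
    qed
    then show "(\<forall>j\<le>l. p i j k \<le> (1/2) ^ (l - j + 2)) = (\<forall>j\<le>l. p i' j k \<le> (1/2) ^ (l - j + 2))" by simp
  next
    fix l :: nat and i :: "nat \<Rightarrow> nat"
    have "\<forall>\<^sub>F k in sequentially. p i j k < (1/2) ^ (l - j + 2)" for j
      unfolding p_def
      by (rule order_tendstoD(2)[OF bandit_run.visiting_disjoint_tendsto_0[OF run B disj]]) simp
    then have "\<forall>\<^sub>F k in sequentially. \<forall>j\<in>{..l}. p i j k < (1/2) ^ (l - j + 2)"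
      by (intro eventually_ball_finite) auto
    then show "\<exists>k. \<forall>j\<le>l. p i j k \<le> (1/2) ^ (l - j + 2)"
      by (auto simp: eventually_sequentially intro: less_imp_le)
  qed
  then obtain i where i: "\<And>l j. j \<le> l \<Longrightarrow> p i j (i l) \<le> (1/2) ^ (l - j + 2)" by blast
  interpret needle_family X D "\<lambda>l. a (i l)" c r by (rule fam)
  interpret U: bandit_run M A "\<nu> i UNIV" by (rule run)

  \<comment> \<open>The supremum is the limit of the heights; every single needle stays strictly
    below it.\<close>
  have "(SUP x\<in>space M. \<mu> i UNIV x) = r"
  proof (rule antisym)
    show "(SUP x\<in>space M. \<mu> i UNIV x) \<le> r"
      using sp a needles_range by (intro cSUP_least) (auto simp: \<mu>_def)
    show "r \<le> (SUP x\<in>space M. \<mu> i UNIV x)"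
    proof (rule LIMSEQ_le_const2)
      show "c \<longlonglongrightarrow> r"
      proof -
        have "(\<lambda>l. r - r * (1/2) ^ Suc l) \<longlonglongrightarrow> r - r * 0"
          by (intro tendsto_intros LIMSEQ_Suc LIMSEQ_power_zero) simp
        then show ?thesis by (simp add: c_def[abs_def] g_def)
      qed
      have "c l \<le> (SUP x\<in>space M. \<mu> i UNIV x)" for l
      proof -
        have al: "a (i l) \<in> X" using a by blast
        then have "c l \<le> \<mu> i UNIV (a (i l))"
          using needles_upper[of l UNIV "a (i l)"] by (simp add: \<mu>_def)
        also have "\<dots> \<le> (SUP x\<in>space M. \<mu> i UNIV x)"
          using al sp needles_range by (intro cSUP_upper bdd_aboveI2[of _ _ r]) (auto simp: \<mu>_def)
        finally show ?thesis .
      qed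
      then show "\<exists>N. \<forall>n\<ge>N. c n \<le> (SUP x\<in>space M. \<mu> i UNIV x)" by blast
    qed
  qed
  note S = this[symmetric]

  have low: "real (T j) * g j / 2 \<le> regret M A (\<mu> i UNIV) (\<nu> i UNIV) (T j)" for j
  proof -
    interpret J: bandit_run M A "\<nu> i {..<j}" by (rule run)
    interpret PJ: prob_space "J.law (T j)" by (rule J.prob_space_law)
    \<comment> \<open>The balls of the needles from \<open>j\<close> on. Outside \<open>V\<close>
      the full instance coincides with the one having only the needles below \<open>j\<close>, for
      which the choice of \<open>i\<close> controls the visits.\<close>
    define V where "V = (\<Union>l. B (i (l + j)))"
    have V: "V \<in> sets M" unfolding V_def using B by auto
    have off: "\<mu> i UNIV x = \<mu> i {..<j} x" if "x \<in> space M" "x \<notin> V" for x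
      unfolding \<mu>_def
    proof (rule needles_off_balls)
      fix l assume "l \<in> UNIV - {..<j}"
      then have l: "l - j + j = l" by auto
      have "x \<notin> B (i (l - j + j))" using that(2) unfolding V_def by blast
      then have "x \<notin> B (i l)" unfolding l .
      then show "r \<le> D (a (i l)) x" using that(1) sp a by (auto simp: B_def)
    qed (use that sp in auto)
    have gap: "\<mu> i UNIV x \<le> r - g j" if "x \<in> space M" "x \<notin> V" for x
      unfolding off[OF that] unfolding \<mu>_def
    proof (rule needles_least)
      fix l assume "l \<in> {..<j}"
      then have "g j \<le> g (Suc l)" by (intro g_mono) auto
      then show "c l - D x (a (i l)) \<le> r - g j" using nonneg[of x "a (i l)"] c_def[of l] by linarith
    qed (use g_le in simp)
    have "PJ.prob (space (J.histories (T j)) - avoiding M V (T j)) \<le> 1 / 2"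
    proof -
      let ?E = "\<lambda>l. space (J.histories (T j)) - avoiding M (B (i (l + j))) (T j)"
      have E: "range ?E \<subseteq> PJ.events" using J.sets_avoiding[OF B] by auto
      have le: "PJ.prob (?E l) \<le> (1/2) ^ (l + 2)" for l
        using i[of j "l + j"] by (simp add: p_def)
      have geo: "(\<lambda>l. (1/2) ^ (l + 2)) sums (1/2 :: real)"
        using sums_mult[OF geometric_sums[of "1/2 :: real"], of "1/4"] by (simp add: power_add)
      have summ: "summable (\<lambda>l. PJ.prob (?E l))"
        by (rule summable_comparison_test'[OF sums_summable[OF geo], of 0]) (use le in simp)
      have "space (J.histories (T j)) - avoiding M V (T j) = (\<Union>l. ?E l)"
        by (auto simp: avoiding_def V_def)
      then have "PJ.prob (space (J.histories (T j)) - avoiding M V (T j)) \<le> (\<Sum>l. PJ.prob (?E l))"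
        using PJ.finite_measure_subadditive_countably[OF E summ] by simp
      also have "\<dots> \<le> (\<Sum>l. (1/2) ^ (l + 2))"
        by (rule suminf_le[OF le summ sums_summable[OF geo]])
      also have "\<dots> = 1 / 2" using geo by (rule sums_unique[symmetric])
      finally show ?thesis .
    qed
    then have "1 / 2 \<le> PJ.prob (avoiding M V (T j))"
      using PJ.prob_compl[of "avoiding M V (T j)"] J.sets_avoiding[OF V] by (simp add: J.space_law)
    also have "\<dots> = measure (U.law (T j)) (avoiding M V (T j))"
      by (rule measure_avoiding_cong[OF run run V]) (simp add: \<nu>_def off)
    finally have "real (T j) * g j * (1 / 2) \<le> real (T j) * g j * measure (U.law (T j)) (avoiding M V (T j))"
      using g0[of j] by (intro mult_left_mono) auto
    also have "\<dots> \<le> regret M A (\<mu> i UNIV) (\<nu> i UNIV) (T j)"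
    proof (rule U.regret_ge_avoiding[OF _ V _ _ S gap])
      show "\<mu> i UNIV \<in> borel_measurable M"
        unfolding \<mu>_def by (rule measurable_payoff[OF Metric_space_axioms arms needles_Lipschitz])
    qed (auto simp: \<mu>_def needles_range)
    finally show ?thesis by simp
  qed

  obtain C where C: "\<And>t. t \<ge> 1 \<Longrightarrow> regret M A (\<mu> i UNIV) (\<nu> i UNIV) t \<le> C * f t"
    using bound[OF inst] by blast
  obtain j :: nat where j: "2 * \<bar>C\<bar> < real j" using reals_Archimedean2 by blast
  \<comment> \<open>Comparing both bounds at \<open>T j\<close> and cancelling
    \<open>T j * g j\<close> leaves \<open>j + 1 \<le> 2 * \<bar>C\<bar>\<close>, contrary to the
    choice of \<open>j\<close>.\<close>
  have "real (T j) * g j / 2 \<le> C * f (T j)" using low C[OF T(1)] by (rule order_trans)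
  also have "\<dots> \<le> \<bar>C\<bar> * \<bar>f (T j)\<bar>" using abs_ge_self[of "C * f (T j)"] by (simp add: abs_mult)
  also have "\<dots> \<le> \<bar>C\<bar> * (real (T j) * (g j / real (Suc j)))" using T(2) by (rule mult_left_mono) simp
  finally have "real (T j) * g j * real (Suc j) \<le> real (T j) * g j * (2 * \<bar>C\<bar>)"
    by (simp add: field_simps)
  moreover have "real (T j) * g j > 0" using g0[of j] T(1)[of j] by simp
  ultimately have "real (Suc j) \<le> 2 * \<bar>C\<bar>" by (simp only: mult_le_cancel_left_pos)
  with j show False by simp
qed

theorem theorem1p8:
  fixes X :: "'a set" and D :: "'a \<Rightarrow> 'a \<Rightarrow> real" and M :: "'a measure"
  assumes "Metric_space X D" and "X \<noteq> {}"
    and "\<And>x y. x \<in> X \<Longrightarrow> y \<in> X \<Longrightarrow> D x y \<le> 1"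
    and "arm_space X D M"
  shows "(\<exists>f :: nat \<Rightarrow> real. (\<lambda>t. f t / real t) \<longlonglongrightarrow> 0 \<and> tractable X D M f) \<longleftrightarrow>
    compact_space (Metric_space.mtopology (completion_space X D) (completion_dist X D))"
proof -
  interpret Metric_space X D by fact
  have "mtotally_bounded X" if f: "(\<lambda>t. f t / real t) \<longlonglongrightarrow> 0" "tractable X D M f" for f
  proof (rule ccontr)
    assume "\<not> mtotally_bounded X"
    then obtain e and a :: "nat \<Rightarrow> 'a" where "e > 0" "range a \<subseteq> X" "\<And>i j. i \<noteq> j \<Longrightarrow> e \<le> D (a i) (a j)"
      using separated_sequence_if_not_mtotally_bounded by blast
    from not_tractable_if_separated[OF assms(1,4,3) this f(1)] f(2) show False by blast
  qed
  then show ?thesis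
    unfolding compact_completion_iff_mtotally_bounded
    using tractable_if_mtotally_bounded[OF assms(1,2,4)] by blast
qed

end
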